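(* Let $\{\gamma_t: t\in J\}$ be an ancient simple closed solution to the curve shortening flow in $\mathbb{H}^2$. Then $$\lim_{t\to-\infty}A(t)=+\infty,$$ where $A(t)$ denotes the area enclosed by $\gamma_t=\gamma(t,\cdot)$.
   Context: $\mathbb{H}^2$ is the hyperbolic plane of curvature $-1$ (upper half-plane $\{y>0\}$ with metric $\frac{dx^2+dy^2}{y^2}$). A smooth family of curves $\gamma_t$, $t\in J$, is a solution of the curve shortening flow if $(\partial_t\gamma_t)^\perp=\kappa(t,\cdot)N(t,\cdot)$, where $\kappa(t,\cdot)$ and $N(t,\cdot)$ are the geodesic curvature and unit normal of $\gamma_t$ and $\perp$ denotes the normal component. The solution is ancient if its time interval is $J=(-\infty,T_0)$ for some $T_0\le+\infty$. It is simple closed ("simply closed") if each $\gamma_t$ is a simple closed curve. Area is hyperbolic area. *)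

theory Defs
  imports "HOL-Analysis.Analysis"
begin

section \<open>Smooth maps\<close>

text \<open>On an open set of a Euclidean space, \<open>Ck_on k S f\<close> says that all iterated directional
  derivatives of order at most \<open>k\<close> exist and are continuous, i.e. that \<open>f\<close> is of class \<open>C\<^sup>k\<close>.\<close>

primrec Ck_on :: "nat \<Rightarrow> 'a::real_normed_vector set \<Rightarrow> ('a \<Rightarrow> 'b::real_normed_vector) \<Rightarrow> bool" where
  "Ck_on 0 S f \<longleftrightarrow> continuous_on S f"
| "Ck_on (Suc k) S f \<longleftrightarrow>
     (\<forall>x\<in>S. f differentiable (at x)) \<and> (\<forall>v. Ck_on k S (\<lambda>x. frechet_derivative f (at x) v))"

definition smooth_on :: "'a::real_normed_vector set \<Rightarrow> ('a \<Rightarrow> 'b::real_normed_vector) \<Rightarrow> bool" where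
  "smooth_on S f \<longleftrightarrow> open S \<and> (\<forall>k. Ck_on k S f)"

section \<open>The upper half-plane\<close>

definition upper_half_plane :: "complex set" where
  "upper_half_plane = {z. 0 < Im z}"

text \<open>The metric \<open>(dx\<^sup>2 + dy\<^sup>2) / y\<^sup>2\<close>; tangent vectors at \<open>z\<close> are complex numbers.\<close>

definition hyp_inner :: "complex \<Rightarrow> complex \<Rightarrow> complex \<Rightarrow> real" where
  "hyp_inner z v w = (v \<bullet> w) / (Im z)\<^sup>2"

definition hyp_norm :: "complex \<Rightarrow> complex \<Rightarrow> real" where
  "hyp_norm z v = sqrt (hyp_inner z v v)"

text \<open>The Christoffel symbols of this metric are
  \<open>\<Gamma>\<^sup>x\<^sub>x\<^sub>y = \<Gamma>\<^sup>x\<^sub>y\<^sub>x = \<Gamma>\<^sup>y\<^sub>y\<^sub>y = -1/y\<close> and \<open>\<Gamma>\<^sup>y\<^sub>x\<^sub>x = 1/y\<close>, the others being zero, so that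
  \<open>\<Gamma>(v, w) = (-(v\<^sub>x w\<^sub>y + v\<^sub>y w\<^sub>x)/y, (v\<^sub>x w\<^sub>x - v\<^sub>y w\<^sub>y)/y)\<close>.  In complex notation this is
  \<open>\<i> v w / y\<close>.  The two lemmas below (zero torsion, compatibility with the metric)
  characterise it as the Levi-Civita connection.\<close>

definition hyp_christoffel :: "complex \<Rightarrow> complex \<Rightarrow> complex \<Rightarrow> complex" where
  "hyp_christoffel z v w = \<i> * v * w / of_real (Im z)"

lemma hyp_christoffel_commute: "hyp_christoffel z v w = hyp_christoffel z w v"
  by (simp add: hyp_christoffel_def)

lemma hyp_inner_has_derivative:
  assumes "z \<in> upper_half_plane"
  shows "((\<lambda>z. hyp_inner z a b) has_derivative
           (\<lambda>v. hyp_inner z (hyp_christoffel z v a) b + hyp_inner z a (hyp_christoffel z v b))) (at z)"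
proof -
  have y: "Im z \<noteq> 0" using assms by (simp add: upper_half_plane_def)
  have "((\<lambda>z. hyp_inner z a b) has_derivative (\<lambda>v. - 2 * Im v * (a \<bullet> b) / (Im z) ^ 3)) (at z)"
    unfolding hyp_inner_def using y
    by (auto intro!: derivative_eq_intros simp: field_simps power2_eq_square power3_eq_cube)
  moreover have "- 2 * Im v * (a \<bullet> b) / (Im z) ^ 3 =
      hyp_inner z (hyp_christoffel z v a) b + hyp_inner z a (hyp_christoffel z v b)" for v
    using y by (simp add: hyp_inner_def hyp_christoffel_def inner_complex_def field_simps
        power2_eq_square power3_eq_cube)
  ultimately show ?thesis by simp
qed

definition hyp_area_measure :: "complex measure" where
  "hyp_area_measure =
     density lborel (\<lambda>z. indicator upper_half_plane z * ennreal (1 / (Im z)\<^sup>2))"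

section \<open>Curves in the hyperbolic plane\<close>

text \<open>The covariant derivative along the curve \<open>c\<close> of a vector field \<open>V\<close> along \<open>c\<close>.\<close>

definition cov_deriv :: "(real \<Rightarrow> complex) \<Rightarrow> (real \<Rightarrow> complex) \<Rightarrow> real \<Rightarrow> complex" where
  "cov_deriv c V u = vector_derivative V (at u)
     + hyp_christoffel (c u) (vector_derivative c (at u)) (V u)"

definition hyp_speed :: "(real \<Rightarrow> complex) \<Rightarrow> real \<Rightarrow> real" where
  "hyp_speed c u = hyp_norm (c u) (vector_derivative c (at u))"

definition unit_tangent :: "(real \<Rightarrow> complex) \<Rightarrow> real \<Rightarrow> complex" where
  "unit_tangent c u = vector_derivative c (at u) /\<^sub>R hyp_speed c u"

text \<open>The metric is conformal to the Euclidean one, so multiplication by \<open>\<i>\<close> is the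
  rotation by a right angle.  Choosing \<open>- \<i>\<close> instead would change the sign of both the normal
  and the curvature, and leave the curvature vector unchanged.\<close>

definition unit_normal :: "(real \<Rightarrow> complex) \<Rightarrow> real \<Rightarrow> complex" where
  "unit_normal c u = \<i> * unit_tangent c u"

definition geodesic_curvature :: "(real \<Rightarrow> complex) \<Rightarrow> real \<Rightarrow> real" where
  "geodesic_curvature c u =
     hyp_inner (c u) (cov_deriv c (unit_tangent c) u /\<^sub>R hyp_speed c u) (unit_normal c u)"

definition normal_component :: "(real \<Rightarrow> complex) \<Rightarrow> real \<Rightarrow> complex \<Rightarrow> complex" where
  "normal_component c u v = v - hyp_inner (c u) v (unit_tangent c u) *\<^sub>R unit_tangent c u"

text \<open>Closed curves are parametrised by \<open>\<real>/\<int>\<close>, i.e. by 1-periodic functions on \<open>\<real>\<close>;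
  \<open>simple_path\<close> refers to the restriction to \<open>[0, 1]\<close> and allows the end points to coincide.\<close>

definition simple_closed_curve :: "(real \<Rightarrow> complex) \<Rightarrow> bool" where
  "simple_closed_curve c \<longleftrightarrow> (\<forall>u. c (u + 1) = c u) \<and> simple_path c"

definition enclosed_area :: "(real \<Rightarrow> complex) \<Rightarrow> real" where
  "enclosed_area c = measure hyp_area_measure (inside (path_image c))"

section \<open>Curve shortening flow\<close>

text \<open>\<open>\<gamma> t u\<close> is the point with parameter \<open>u\<close> of the curve at time \<open>t\<close>, where \<open>t\<close> ranges over
  the open interval \<open>J\<close>.  The curves are immersed, as is needed for the unit normal to exist.\<close>

definition smooth_curve_family :: "real set \<Rightarrow> (real \<Rightarrow> real \<Rightarrow> complex) \<Rightarrow> bool" where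
  "smooth_curve_family J \<gamma> \<longleftrightarrow>
     smooth_on (J \<times> UNIV) (\<lambda>(t, u). \<gamma> t u) \<and>
     (\<forall>t\<in>J. \<forall>u. \<gamma> t u \<in> upper_half_plane \<and> vector_derivative (\<gamma> t) (at u) \<noteq> 0)"

definition csf_solution :: "real set \<Rightarrow> (real \<Rightarrow> real \<Rightarrow> complex) \<Rightarrow> bool" where
  "csf_solution J \<gamma> \<longleftrightarrow> smooth_curve_family J \<gamma> \<and>
     (\<forall>t\<in>J. \<forall>u. normal_component (\<gamma> t) u (vector_derivative (\<lambda>s. \<gamma> s u) (at t))
        = geodesic_curvature (\<gamma> t) u *\<^sub>R unit_normal (\<gamma> t) u)"

definition ancient_interval :: "real set \<Rightarrow> bool" where
  "ancient_interval J \<longleftrightarrow> (\<exists>T0::ereal. - \<infinity> < T0 \<and> J = {t. ereal t < T0})"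

end

theory Submission
  imports Defs "HOL-Complex_Analysis.Complex_Analysis"
begin

text \<open>The area \<open>A\<close> enclosed by a simple closed solution satisfies \<open>A' = - (2 \<pi> + A)\<close>, by the first
  variation of area and the theorem of Gauss and Bonnet.  As \<open>A\<close> is nonnegative, \<open>A' \<le> - 2 \<pi>\<close>, so
  \<open>A\<close> grows at least linearly as time runs back to \<open>-\<infinity>\<close>.

  The differential equation comes from a computation with line integrals.  In the half-plane, a curve
  \<open>c\<close> with hyperbolic speed \<open>\<sigma>\<close> and geodesic curvature \<open>\<kappa>\<close> satisfies
  \<open>\<kappa> \<sigma> = Im (c'' / c') + Re c' / Im c\<close> (\<open>curvature_times_speed\<close>).  The integral of the first term over
  a period is \<open>2 \<pi>\<close> times the turning number of \<open>c\<close>, i.e. the winding number of \<open>c'\<close> around \<open>0\<close>.  The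
  second term is the pullback of the one-form \<open>dx / y\<close>, whose exterior derivative is the hyperbolic area
  form, so that its integral \<open>a\<close> is the signed area.  Differentiating \<open>a\<close> in time and integrating by
  parts over a period turns the flow equation into \<open>a' = - \<integral> \<kappa> \<sigma>\<close>.

  Two global facts about plane curves make this precise.

  First, the turning number of a simple closed curve is \<open>1\<close> or \<open>- 1\<close>, and it has the sign of the winding
  number around the inner points (\<open>turning_number_eq_winding_number_inside\<close>).  Following Hopf, consider
  the chords \<open>c t - c s\<close>, divided by \<open>(t - s) (1 - (t - s))\<close>: they extend to a nonvanishing continuous
  function on the triangle \<open>0 \<le> s \<le> t \<le> 1\<close>, whose diagonal values are \<open>c'\<close>.  A logarithm on the
  triangle shows that the turning number is twice the (half-odd) winding \<open>w\<close> of the chords from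
  \<open>c 0\<close>.  On the other hand, \<open>2 w\<close> is the sum of the winding numbers of \<open>c\<close> around two points just to
  the left and to the right of \<open>c 0\<close>.  Each of these two numbers is \<open>0\<close> or the winding number around
  inner points; as their sum is odd, it is the latter.

  Second, the signed area equals the integral of \<open>dx / y\<close> (\<open>enclosed_area_eq_line_integral\<close>).  This
  instance of Green's formula is derived from the Cauchy integral for the winding number: integrate
  \<open>winding_number c z / (Im z)\<^sup>2\<close> over a large rectangle, exchange the two integrals, and compute the
  integral of the Cauchy kernel over horizontal segments.  As the segments grow to full lines, the
  kernel integrates to a step function of the height, and integrating that step function against
  \<open>1 / y\<^sup>2\<close> gives \<open>1 / Im c\<close> up to a constant, which contributes nothing along a closed curve.

  The sign of the turning number is constant in time, because it depends continuously on time.\<close>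

section \<open>Winding numbers via continuous logarithms\<close>

text \<open>The paths need not be closed here, so winding numbers of open paths can be added and compared.\<close>

lemma winding_number_eq_log_change:
  assumes L: "continuous_on {0..1} L" and f: "\<And>t. t \<in> {0..1} \<Longrightarrow> f t = exp (L t)"
  shows "2 * of_real pi * \<i> * winding_number f 0 = L 1 - L 0"
proof -
  have "path L" using L by (simp add: path_def)
  then have "winding_number (exp \<circ> L) 0 = (L 1 - L 0) / (2 * of_real pi * \<i>)"
    by (simp add: winding_number_compose_exp pathfinish_def pathstart_def)
  moreover have "winding_number f 0 = winding_number (exp \<circ> L) 0"
    by (rule winding_number_cong) (use f in auto)
  ultimately show ?thesis by simp
qed

lemma obtain_log:
  assumes "continuous_on {0..1} f" and "\<And>t. t \<in> {0..1} \<Longrightarrow> f t \<noteq> (0::complex)"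
  obtains L where "continuous_on {0..1::real} L" "\<And>t. t \<in> {0..1} \<Longrightarrow> f t = exp (L t)"
  using continuous_logarithm_on_contractible[OF assms(1) convex_imp_contractible assms(2)]
  by (auto simp: convex_real_interval)

lemma winding_number_mult:
  assumes "continuous_on {0..1} f" "\<And>t. t \<in> {0..1} \<Longrightarrow> f t \<noteq> 0"
    and "continuous_on {0..1} g" "\<And>t. t \<in> {0..1} \<Longrightarrow> g t \<noteq> 0"
  shows "winding_number (\<lambda>t. f t * g t) 0 = winding_number f 0 + winding_number g 0"
proof -
  obtain L where L: "continuous_on {0..1} L" "\<And>t. t \<in> {0..1} \<Longrightarrow> f t = exp (L t)"
    using obtain_log[OF assms(1,2)] by blast
  obtain M where M: "continuous_on {0..1} M" "\<And>t. t \<in> {0..1} \<Longrightarrow> g t = exp (M t)"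
    using obtain_log[OF assms(3,4)] by blast
  have "2 * of_real pi * \<i> * winding_number (\<lambda>t. f t * g t) 0 = (L 1 + M 1) - (L 0 + M 0)"
    by (rule winding_number_eq_log_change) (auto simp: exp_add L M intro!: continuous_intros)
  also have "\<dots> = 2 * of_real pi * \<i> * (winding_number f 0 + winding_number g 0)"
    using winding_number_eq_log_change[OF L] winding_number_eq_log_change[OF M]
    by (simp add: distrib_left)
  finally show ?thesis by simp
qed

text \<open>The principal logarithm is continuous on the right half-plane.\<close>

lemma winding_number_right_half_plane:
  assumes "continuous_on {0..1} f" "\<And>t. t \<in> {0..1} \<Longrightarrow> Re (f t) > 0" "f 0 = f 1"
  shows "winding_number f 0 = 0"
proof -
  have "2 * of_real pi * \<i> * winding_number f 0 = Ln (f 1) - Ln (f 0)"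
  proof (rule winding_number_eq_log_change)
    show "continuous_on {0..1} (\<lambda>t. Ln (f t))"
      by (rule continuous_on_compose2[OF continuous_on_Ln assms(1), of "{z. Re z > 0}"])
        (use assms(2) in \<open>auto simp: complex_nonpos_Reals_iff\<close>)
    show "f t = exp (Ln (f t))" if "t \<in> {0..1}" for t
      using assms(2)[OF that] by (metis exp_Ln less_irrefl zero_complex.simps(1))
  qed
  then show ?thesis using assms(3) by simp
qed

section \<open>Chords of a closed curve\<close>

locale closed_C1_curve =
  fixes c c' :: "real \<Rightarrow> complex"
  assumes has_deriv: "\<And>u. (c has_vector_derivative c' u) (at u)"
    and cont_deriv: "continuous_on UNIV c'"
    and periodic: "\<And>u. c (u + 1) = c u"
begin

lemma periodic_deriv: "c' (u + 1) = c' u"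
proof -
  have "((\<lambda>u. c (u + 1)) has_vector_derivative c' (u + 1)) (at u)"
    using vector_diff_chain_at[of "\<lambda>u. u + 1" 1 u c "c' (u + 1)", OF _ has_deriv]
    by (simp add: o_def has_vector_derivative_add_const has_vector_derivative_id)
  then have "(c has_vector_derivative c' (u + 1)) (at u)"
    by (simp add: periodic)
  then show ?thesis using has_deriv vector_derivative_unique_at by blast
qed

lemma cont: "continuous_on S c"
  by (meson continuous_at_imp_continuous_on has_deriv has_vector_derivative_continuous)

lemma path: "path c"
  by (simp add: path_def cont)

lemma pathfinish: "pathfinish c = pathstart c"
  using periodic[of 0] by (simp add: pathfinish_def pathstart_def)

text \<open>The difference quotient of the curve; written as an integral of the derivative, it is visibly
  continuous up to the diagonal.\<close>

definition slope :: "real \<Rightarrow> real \<Rightarrow> complex" where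
  "slope a b = integral {0..1} (\<lambda>\<tau>. c' (a + \<tau> * (b - a)))"

lemma slope_eq: "c b - c a = (b - a) *\<^sub>R slope a b"
proof -
  have "((\<lambda>\<tau>. (b - a) *\<^sub>R c' (a + \<tau> * (b - a))) has_integral c (a + 1 * (b - a)) - c (a + 0 * (b - a))) {0..1}"
  proof (rule fundamental_theorem_of_calculus)
    fix x :: real
    have lin: "((\<lambda>\<tau>. a + \<tau> * (b - a)) has_vector_derivative (b - a)) (at x)"
      by (auto intro!: derivative_eq_intros)
    have "((\<lambda>\<tau>. c (a + \<tau> * (b - a))) has_vector_derivative (b - a) *\<^sub>R c' (a + x * (b - a))) (at x)"
      using vector_diff_chain_at[of "\<lambda>\<tau>. a + \<tau> * (b - a)" "b - a" x c "c' (a + x * (b - a))", OF lin has_deriv]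
      by (simp add: o_def)
    then show "((\<lambda>\<tau>. c (a + \<tau> * (b - a))) has_vector_derivative (b - a) *\<^sub>R c' (a + x * (b - a))) (at x within {0..1})"
      by (rule has_vector_derivative_at_within)
  qed simp
  then have "integral {0..1} (\<lambda>\<tau>. (b - a) *\<^sub>R c' (a + \<tau> * (b - a))) = c b - c a"
    by (simp only: integral_unique) simp
  then show ?thesis by (simp add: slope_def)
qed

lemma slope_refl: "slope a a = c' a"
  by (simp add: slope_def)

lemma continuous_slope: "continuous_on UNIV (\<lambda>(a, b). slope a b)"
proof -
  have "continuous_on UNIV (\<lambda>p. integral (cbox 0 1) (\<lambda>\<tau>::real. c' (fst p + \<tau> * (snd p - fst p))))"
    by (rule integral_continuous_on_param)
      (auto simp: case_prod_unfold intro!: continuous_intros continuous_on_compose2[OF cont_deriv])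
  then show ?thesis by (simp add: slope_def case_prod_unfold)
qed

text \<open>The quotient of \<open>c t - c s\<close> by \<open>(t - s) (1 - (t - s))\<close>, extended continuously to \<open>t = s\<close> and to
  \<open>t = s + 1\<close>.  The formula comes from \<open>1 / (r (1 - r)) = 1 / r + 1 / (1 - r)\<close> and periodicity: the two
  summands are difference quotients over \<open>[s, t]\<close> and over \<open>[t - 1, s]\<close>.\<close>

definition chord :: "real \<Rightarrow> real \<Rightarrow> complex" where
  "chord s t = slope s t - slope (t - 1) s"

lemma chord_eq: "((t - s) * (1 - (t - s))) *\<^sub>R chord s t = c t - c s"
proof -
  have 1: "(t - s) *\<^sub>R slope s t = c t - c s" by (simp add: slope_eq)
  have 2: "(s - (t - 1)) *\<^sub>R slope (t - 1) s = c s - c t"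
    using slope_eq[of s "t - 1"] periodic[of "t - 1"] by simp
  have "((t - s) * (1 - (t - s))) *\<^sub>R chord s t = (1 - (t - s)) *\<^sub>R ((t - s) *\<^sub>R slope s t)
     - (t - s) *\<^sub>R ((s - (t - 1)) *\<^sub>R slope (t - 1) s)"
    by (simp add: chord_def scaleR_conv_of_real algebra_simps)
  also have "\<dots> = c t - c s" unfolding 1 2 by (simp add: scaleR_conv_of_real algebra_simps)
  finally show ?thesis .
qed

lemma chord_refl: "chord s s = c' s"
  using slope_eq[of s "s - 1"] periodic[of "s - 1"] by (simp add: chord_def slope_refl)

lemma chord_period: "chord 0 1 = - c' 0"
  using slope_eq[of 1 0] periodic[of 0] by (simp add: chord_def slope_refl)

lemma continuous_chord: "continuous_on S (\<lambda>(s, t). chord s t)"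
  unfolding chord_def case_prod_unfold
  by (intro continuous_intros; rule continuous_on_compose2[OF continuous_slope, unfolded case_prod_unfold,
      where f="\<lambda>p. (_ p, _ p)", simplified]) (auto intro!: continuous_intros)

end


section \<open>The turning number of a simple closed curve\<close>

locale simple_closed_C1_curve = closed_C1_curve +
  assumes simple: "simple_path c"
    and regular: "\<And>u. c' u \<noteq> 0"
begin

text \<open>Inside the triangle this is injectivity of the curve; on the diagonal and at the corner \<open>(0, 1)\<close> it is
  regularity.\<close>

lemma chord_nonzero:
  assumes "0 \<le> s" "s \<le> t" "t \<le> 1"
  shows "chord s t \<noteq> 0"
proof -
  consider "s = t" | "s = 0" "t = 1" | "s < t" "t - s < 1"
    using assms by linarith
  then show ?thesis
  proof cases
    case 1
    then show ?thesis using regular by (simp add: chord_refl)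
  next
    case 2
    then show ?thesis using regular by (simp add: chord_period)
  next
    case 3
    have "c t \<noteq> c s"
      using simple assms 3 unfolding simple_path_def loop_free_def by force
    then show ?thesis using chord_eq[of t s] by auto
  qed
qed

lemma continuous_chord_0: "continuous_on S (chord 0)"
  using continuous_on_compose2[OF continuous_chord[of UNIV], of S "\<lambda>t. (0, t)"]
  by (simp add: continuous_on_Pair)

text \<open>Compare the change of a logarithm of the chord function along the diagonal of Hopf's triangle with
  its changes along the two legs.  On the leg \<open>t = 1\<close> the chord is the negative of the one on the leg
  \<open>s = 0\<close>, so both legs contribute equally.  The chords from \<open>c 0\<close> start in the direction \<open>c' 0\<close> and end in
  the opposite one, whence the second claim: their winding is half an odd integer.\<close>

lemma turning_number_chord:
  "winding_number c' 0 = 2 * winding_number (chord 0) 0"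
  "exp (2 * of_real pi * \<i> * winding_number (chord 0) 0) = - 1"
proof -
  \<comment> \<open>Hopf's triangle.\<close>
  define T where "T = {(s, t). 0 \<le> s \<and> s \<le> t \<and> t \<le> (1::real)}"
  have "T = {p. (1, 0) \<bullet> p \<ge> 0} \<inter> {p. (1, - 1) \<bullet> p \<le> 0} \<inter> {p. (0, 1) \<bullet> p \<le> 1}"
    by (auto simp: T_def inner_prod_def)
  then have "convex T"
    by (simp add: convex_Int convex_halfspace_le convex_halfspace_ge)
  then obtain \<Lambda> where \<Lambda>: "continuous_on T \<Lambda>" "\<And>x. x \<in> T \<Longrightarrow> (\<lambda>(s, t). chord s t) x = exp (\<Lambda> x)"
    using continuous_logarithm_on_contractible[OF continuous_chord[of T] convex_imp_contractible]
      chord_nonzero unfolding T_def by (smt (verit, ccfv_threshold) case_prod_conv mem_Collect_eq prod.exhaust_sel)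
  have diag: "2 * of_real pi * \<i> * winding_number c' 0 = \<Lambda> (1, 1) - \<Lambda> (0, 0)"
    by (rule winding_number_eq_log_change[of "\<lambda>t. \<Lambda> (t, t)"])
      (use \<Lambda>(2)[of "(t, t)" for t] in \<open>auto simp: T_def chord_refl
        intro!: continuous_intros continuous_on_compose2[OF \<Lambda>(1)]\<close>)
  have left: "2 * of_real pi * \<i> * winding_number (chord 0) 0 = \<Lambda> (0, 1) - \<Lambda> (0, 0)"
    by (rule winding_number_eq_log_change[of "\<lambda>t. \<Lambda> (0, t)"])
      (use \<Lambda>(2)[of "(0, t)" for t] in \<open>auto simp: T_def
        intro!: continuous_intros continuous_on_compose2[OF \<Lambda>(1)]\<close>)
  have top: "2 * of_real pi * \<i> * winding_number (\<lambda>s. chord s 1) 0 = \<Lambda> (1, 1) - \<Lambda> (0, 1)"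
    by (rule winding_number_eq_log_change[of "\<lambda>t. \<Lambda> (t, 1)"])
      (use \<Lambda>(2)[of "(t, 1)" for t] in \<open>auto simp: T_def
        intro!: continuous_intros continuous_on_compose2[OF \<Lambda>(1)]\<close>)
  have opp: "chord s 1 = - 1 * chord 0 s" if "s \<in> {0..1}" for s
  proof -
    consider "s = 0" | "s = 1" | "0 < s" "s < 1" using \<open>s \<in> {0..1}\<close> by force
    then show ?thesis
    proof cases
      case 3
      have "(s * (1 - s)) *\<^sub>R chord s 1 = c 1 - c s"
        using chord_eq[of 1 s] by (simp add: mult.commute)
      also have "\<dots> = (s * (1 - s)) *\<^sub>R (- chord 0 s)"
        using chord_eq[of s 0] periodic[of 0] by simp
      finally show ?thesis using 3 unfolding scaleR_cancel_left by simp
    qed (use periodic_deriv[of 0] in \<open>auto simp: chord_refl chord_period\<close>)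
  qed
  have "winding_number (\<lambda>s. chord s 1) 0 = winding_number (\<lambda>s. - 1 * chord 0 s) 0"
    by (rule winding_number_cong) (use opp in auto)
  also have "\<dots> = winding_number (\<lambda>s. - 1) 0 + winding_number (chord 0) 0"
    by (rule winding_number_mult) (use continuous_chord_0 chord_nonzero in auto)
  also have "winding_number (\<lambda>s. - 1) 0 = 0"
    by (rule winding_number_constI[of "- 1"]) auto
  finally have "winding_number (\<lambda>s. chord s 1) 0 = winding_number (chord 0) 0" by simp
  then have "2 * of_real pi * \<i> * winding_number (chord 0) 0 = \<Lambda> (1, 1) - \<Lambda> (0, 1)"
    using top by simp
  then have "2 * of_real pi * \<i> * winding_number c' 0 =
      2 * of_real pi * \<i> * winding_number (chord 0) 0 + 2 * of_real pi * \<i> * winding_number (chord 0) 0"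
    using diag left by (metis add_diff_eq diff_add_cancel)
  then have "2 * of_real pi * \<i> * winding_number c' 0 = 2 * of_real pi * \<i> * (2 * winding_number (chord 0) 0)"
    by (simp only: mult_2 distrib_left)
  then show "winding_number c' 0 = 2 * winding_number (chord 0) 0"
    by simp
  have "exp (\<Lambda> (0, 1) - \<Lambda> (0, 0)) = chord 0 1 / chord 0 0"
    using \<Lambda>(2)[of "(0, 1)"] \<Lambda>(2)[of "(0, 0)"] by (simp add: exp_diff T_def)
  then show "exp (2 * of_real pi * \<i> * winding_number (chord 0) 0) = - 1"
    using regular[of 0] left by (simp add: chord_refl chord_period)
qed

text \<open>With \<open>g\<close> the chords from \<open>c 0\<close> and \<open>a = c' 0\<close>, take \<open>p\<close> and \<open>q\<close> to be \<open>c 0 \<plusminus> \<i> \<delta> a\<close> for small \<open>\<delta>\<close>, two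
  points on either side of the curve.  Then \<open>(c - p) (c - q) = (c - c 0)\<^sup>2 + \<delta>\<^sup>2 a\<^sup>2 = m g\<^sup>2 + \<delta>\<^sup>2 a\<^sup>2\<close>
  with \<open>m = (s (1 - s))\<^sup>2\<close>.  Divided by \<open>m + \<delta>\<^sup>2\<close>, this is a weighted mean of \<open>g\<^sup>2\<close> and \<open>a\<^sup>2\<close>.  It is close
  to \<open>g\<^sup>2\<close> everywhere: near the end points because \<open>g\<^sup>2\<close> itself is close to \<open>a\<^sup>2\<close>, elsewhere because
  \<open>m\<close> dominates \<open>\<delta>\<^sup>2\<close>.  Hence the product winds around \<open>0\<close> as often as \<open>g\<^sup>2\<close> does.\<close>

lemma winding_numbers_on_both_sides:
  obtains p q where "p \<notin> path_image c" "q \<notin> path_image c"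
    "winding_number c p + winding_number c q = 2 * winding_number (chord 0) 0"
proof -
  define g where "g = chord 0"
  define a where "a = c' 0"
  define m where "m s = (s * (1 - s))\<^sup>2" for s :: real
  have g: "continuous_on S g" for S by (simp add: g_def continuous_chord_0)
  have g0: "g s \<noteq> 0" if "s \<in> {0..1}" for s using that chord_nonzero by (auto simp: g_def)
  have ends: "g 0 = a" "g 1 = - a" by (auto simp: g_def a_def chord_refl chord_period)
  have cg: "c s = c 0 + of_real (s * (1 - s)) * g s" for s
    using chord_eq[of s 0] by (simp add: g_def scaleR_conv_of_real algebra_simps)
  obtain s0 where s0: "s0 \<in> {0..1}" "\<And>s. s \<in> {0..1} \<Longrightarrow> cmod ((g s0)\<^sup>2) \<le> cmod ((g s)\<^sup>2)"
    using continuous_attains_inf[of "{0..1::real}" "\<lambda>s. cmod ((g s)\<^sup>2)"] g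
    by (fastforce intro!: continuous_intros)
  define e where "e = cmod ((g s0)\<^sup>2)"
  have "e > 0" using g0[OF s0(1)] by (simp add: e_def)
  \<comment> \<open>\<open>K\<close> is where \<open>a\<^sup>2\<close> is too far from \<open>g\<^sup>2\<close>; there \<open>m\<close> is bounded away from \<open>0\<close>, and \<open>\<delta>\<close> is chosen accordingly.\<close>
  define K where "K = {0..1} \<inter> {s. e \<le> cmod (a\<^sup>2 - (g s)\<^sup>2)}"
  have "closed {s. e \<le> cmod (a\<^sup>2 - (g s)\<^sup>2)}"
    by (intro closed_Collect_le continuous_intros g)
  then have "compact K" unfolding K_def by (intro compact_Int_closed) auto
  have mK: "m s \<noteq> 0" if "s \<in> K" for s
    using that ends \<open>e > 0\<close> by (auto simp: K_def m_def)
  have "compact ((\<lambda>s. (a\<^sup>2 - (g s)\<^sup>2) / of_real (m s)) ` K)"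
    by (rule compact_continuous_image[OF _ \<open>compact K\<close>])
      (use mK in \<open>auto simp: m_def intro!: continuous_intros g\<close>)
  then obtain B where B: "B > 0" "\<And>s. s \<in> K \<Longrightarrow> cmod ((a\<^sup>2 - (g s)\<^sup>2) / of_real (m s)) \<le> B"
    using compact_imp_bounded bounded_pos by (metis (no_types, lifting) imageI)
  define \<delta> where "\<delta> = sqrt (e / (B + 1))"
  have \<delta>2: "\<delta>\<^sup>2 = e / (B + 1)" "\<delta> > 0" using \<open>e > 0\<close> \<open>B > 0\<close> by (auto simp: \<delta>_def)
  have mpos: "m s + \<delta>\<^sup>2 > 0" "m s \<ge> 0" for s
    using \<delta>2(2) by (auto simp: m_def intro: add_nonneg_pos)
  define f where "f s = (of_real (m s) * (g s)\<^sup>2 + of_real (\<delta>\<^sup>2) * a\<^sup>2) / of_real (m s + \<delta>\<^sup>2)" for s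
  have close: "cmod (f s - (g s)\<^sup>2) < cmod ((g s)\<^sup>2)" if s: "s \<in> {0..1}" for s
  proof -
    have nz: "complex_of_real (m s + \<delta>\<^sup>2) \<noteq> 0" using mpos(1)[of s] by (metis less_irrefl of_real_eq_0_iff)
    have "f s - (g s)\<^sup>2 = of_real (\<delta>\<^sup>2 / (m s + \<delta>\<^sup>2)) * (a\<^sup>2 - (g s)\<^sup>2)"
      using nz unfolding f_def by (simp add: divide_simps) (simp add: algebra_simps)
    then have eq: "cmod (f s - (g s)\<^sup>2) = \<delta>\<^sup>2 / (m s + \<delta>\<^sup>2) * cmod (a\<^sup>2 - (g s)\<^sup>2)"
      using mpos[of s] by (simp only: norm_mult norm_of_real) simp
    have "cmod (f s - (g s)\<^sup>2) < e"
    proof (cases "s \<in> K")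
      case True
      have "m s > 0" using mK[OF True] mpos(2)[of s] by simp
      have "\<delta>\<^sup>2 / (m s + \<delta>\<^sup>2) * cmod (a\<^sup>2 - (g s)\<^sup>2) \<le> \<delta>\<^sup>2 / m s * cmod (a\<^sup>2 - (g s)\<^sup>2)"
        using \<open>m s > 0\<close> mpos(1)[of s] by (intro mult_right_mono divide_left_mono) auto
      also have "\<dots> = \<delta>\<^sup>2 * cmod ((a\<^sup>2 - (g s)\<^sup>2) / of_real (m s))"
        using \<open>m s > 0\<close> by (simp add: norm_divide)
      also have "\<dots> \<le> \<delta>\<^sup>2 * B" using B(2)[OF True] by (intro mult_left_mono) auto
      also have "\<dots> < e" using \<open>e > 0\<close> \<open>B > 0\<close> by (simp add: \<delta>2 field_simps)
      finally show ?thesis using eq by simp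
    next
      case False
      then have "cmod (a\<^sup>2 - (g s)\<^sup>2) < e" using s by (auto simp: K_def)
      moreover have "\<delta>\<^sup>2 / (m s + \<delta>\<^sup>2) * cmod (a\<^sup>2 - (g s)\<^sup>2) \<le> 1 * cmod (a\<^sup>2 - (g s)\<^sup>2)"
        using mpos[of s] by (intro mult_right_mono) auto
      ultimately show ?thesis using eq by simp
    qed
    also have "e \<le> cmod ((g s)\<^sup>2)" using s0(2)[OF s] by (simp add: e_def)
    finally show ?thesis .
  qed
  define r where "r s = f s / (g s)\<^sup>2" for s
  have r_pos: "Re (r s) > 0" if s: "s \<in> {0..1}" for s
  proof -
    have "cmod (r s - 1) = cmod (f s - (g s)\<^sup>2) / cmod ((g s)\<^sup>2)"
      using g0[OF s] by (simp add: r_def diff_divide_distrib flip: norm_divide)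
    also have "\<dots> < 1" using close[OF s] g0[OF s] by simp
    finally have "\<bar>Re (r s - 1)\<bar> < 1" using abs_Re_le_cmod le_less_trans by blast
    then show ?thesis by simp
  qed
  have m_nz: "complex_of_real ((s * (1 - s))\<^sup>2 + \<delta>\<^sup>2) \<noteq> 0" for s
    using mpos(1)[of s] by (metis less_irrefl m_def of_real_eq_0_iff)
  have cr: "continuous_on {0..1} r"
    unfolding r_def f_def m_def
    by (intro continuous_intros g ballI m_nz) (use g0 in auto)
  have r_ends: "r 0 = 1" "r 1 = 1"
    using \<delta>2(2) g0[of 0] ends by (auto simp: r_def f_def m_def)
  define p where "p = c 0 + \<i> * of_real \<delta> * a"
  define q where "q = c 0 - \<i> * of_real \<delta> * a"
  have fact: "(c s - p) * (c s - q) = (g s * g s) * (r s * of_real (m s + \<delta>\<^sup>2))" if "s \<in> {0..1}" for s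
  proof -
    have "(c s - p) * (c s - q) = (of_real (s * (1 - s)) * g s)\<^sup>2 + (of_real \<delta> * a)\<^sup>2"
      by (simp add: p_def q_def cg[of s] power2_eq_square algebra_simps)
    also have "\<dots> = f s * of_real (m s + \<delta>\<^sup>2)"
      using mpos(1)[of s] by (simp add: f_def m_def power_mult_distrib del: of_real_add)
    also have "\<dots> = (g s * g s) * (r s * of_real (m s + \<delta>\<^sup>2))"
      using g0[OF that] by (simp add: r_def power2_eq_square)
    finally show ?thesis .
  qed
  have fact_nz: "(c s - p) * (c s - q) \<noteq> 0" if "s \<in> {0..1}" for s
    unfolding fact[OF that] using g0[OF that] r_pos[OF that] mpos(1)[of s]
    by (auto simp del: of_real_add)
  have nz: "c s \<noteq> p" "c s \<noteq> q" if "s \<in> {0..1}" for s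
    using fact_nz[OF that] by auto
  have cm: "continuous_on {0..1} (\<lambda>s. complex_of_real (m s + \<delta>\<^sup>2))"
    unfolding m_def by (intro continuous_intros)
  have "winding_number c p + winding_number c q =
      winding_number (\<lambda>s. (c s - p) * (c s - q)) 0"
    unfolding winding_number_offset[of c p] winding_number_offset[of c q]
    by (rule winding_number_mult[symmetric]) (use nz in \<open>auto intro!: continuous_intros cont\<close>)
  also have "\<dots> = winding_number (\<lambda>s. (g s * g s) * (r s * of_real (m s + \<delta>\<^sup>2))) 0"
    by (rule winding_number_cong) (use fact in auto)
  also have "\<dots> = winding_number (\<lambda>s. g s * g s) 0 + winding_number (\<lambda>s. r s * of_real (m s + \<delta>\<^sup>2)) 0"
    by (rule winding_number_mult) (use g0 fact_nz fact in \<open>auto intro!: continuous_intros g cr cm simp del: of_real_add\<close>)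
  also have "winding_number (\<lambda>s. r s * of_real (m s + \<delta>\<^sup>2)) 0 = 0"
    by (rule winding_number_right_half_plane)
      (use r_pos mpos r_ends in \<open>auto intro!: continuous_intros cr cm mult_pos_pos simp: m_def simp del: of_real_add\<close>)
  also have "winding_number (\<lambda>s. g s * g s) 0 = winding_number g 0 + winding_number g 0"
    by (rule winding_number_mult) (use g0 g in auto)
  finally have "winding_number c p + winding_number c q = 2 * winding_number (chord 0) 0"
    by (simp add: g_def)
  moreover have "p \<notin> path_image c" "q \<notin> path_image c"
    using nz by (auto simp: path_image_def image_iff) metis+
  ultimately show ?thesis using that by blast
qed

text \<open>Both winding numbers beside \<open>c 0\<close> lie in \<open>{0, w}\<close> for the common value \<open>w = \<plusminus>1\<close> at the inner points,
  and their sum is odd; so one of them vanishes and the sum is \<open>w\<close>.\<close>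

theorem turning_number_eq_winding_number_inside:
  assumes z: "z \<in> inside (path_image c)"
  shows "winding_number c' 0 = winding_number c z"
proof -
  obtain p q where pq: "p \<notin> path_image c" "q \<notin> path_image c"
    "winding_number c p + winding_number c q = 2 * winding_number (chord 0) 0"
    by (rule winding_numbers_on_both_sides)
  have cases: "winding_number c x \<in> {0, winding_number c z}" if "x \<notin> path_image c" for x
  proof (cases "x \<in> inside (path_image c)")
    case True
    then show ?thesis using z by (metis simple_closed_path_winding_number_inside[OF simple] insertCI)
  next
    case False
    then have "x \<in> outside (path_image c)" using that inside_Un_outside by blast
    then show ?thesis by (simp add: winding_number_zero_in_outside[OF path pathfinish])
  qed
  have "winding_number c z \<in> {1, - 1}"
    using z by (metis simple_closed_path_winding_number_inside[OF simple] insertCI)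
  \<comment> \<open>An integer winding of the chords would make the exponential \<open>1\<close> instead of \<open>- 1\<close>.\<close>
  then have nint: "winding_number (chord 0) 0 \<notin> {0, winding_number c z}"
    using turning_number_chord(2) by (auto simp: exp_minus exp_two_pi_i exp_two_pi_i')
  show ?thesis
    using cases[OF pq(1)] cases[OF pq(2)] pq(3) nint turning_number_chord(1) by auto
qed

end

section \<open>Integrability of the Cauchy kernel in the plane\<close>

lemma measurable_Complex [measurable]: "(\<lambda>p. Complex (fst p) (snd p)) \<in> borel_measurable (borel :: (real \<times> real) measure)"
  by (intro borel_measurable_continuous_onI) (auto simp: Complex_eq intro!: continuous_intros)

lemma lborel_complex_eq: "lborel = distr (lborel :: (real \<times> real) measure) borel (\<lambda>p. Complex (fst p) (snd p))"
proof (rule lborel_eqI)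
  fix l u :: complex
  assume le: "\<And>b. b \<in> Basis \<Longrightarrow> l \<bullet> b \<le> u \<bullet> b"
  have "p \<in> box (Re l, Im l) (Re u, Im u) \<longleftrightarrow> Complex (fst p) (snd p) \<in> box l u" for p
    by (cases p) (auto simp: in_box_complex_iff mem_box Basis_prod_def)
  then have "(\<lambda>p. Complex (fst p) (snd p)) -` box l u = box (Re l, Im l) (Re u, Im u)"
    by (auto simp: case_prod_unfold)
  then have "emeasure (distr lborel borel (\<lambda>p. Complex (fst p) (snd p))) (box l u)
      = emeasure lborel (box (Re l, Im l) (Re u, Im u))"
    by (simp add: emeasure_distr space_borel)
  also have "\<dots> = (\<Prod>b\<in>Basis. ((Re u, Im u) - (Re l, Im l)) \<bullet> b)"
    using le[of 1] le[of \<i>] by (intro emeasure_lborel_box) (auto simp: Basis_prod_def Basis_complex_def)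
  also have "\<dots> = (\<Prod>b\<in>Basis. (u - l) \<bullet> b)"
    by (simp add: Basis_prod_def Basis_complex_def prod.union_disjoint mult.commute)
  finally show "emeasure (distr lborel borel (\<lambda>p. Complex (fst p) (snd p))) (box l u) = (\<Prod>b\<in>Basis. (u - l) \<bullet> b)" .
qed simp

lemma measurable_Complex_pair [measurable (raw)]:
  "f \<in> borel_measurable M \<Longrightarrow> g \<in> borel_measurable M \<Longrightarrow> (\<lambda>w. Complex (f w) (g w)) \<in> borel_measurable M"
  by (simp add: borel_measurable_complex_iff)

lemma nn_integral_complex:
  assumes [measurable]: "f \<in> borel_measurable borel"
  shows "(\<integral>\<^sup>+z. f z \<partial>lborel) = (\<integral>\<^sup>+y. \<integral>\<^sup>+x. f (Complex x y) \<partial>lborel \<partial>lborel)"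
proof -
  have "(\<integral>\<^sup>+z. f z \<partial>lborel) = (\<integral>\<^sup>+p. f (Complex (fst p) (snd p)) \<partial>(lborel \<Otimes>\<^sub>M lborel))"
    unfolding lborel_complex_eq by (subst nn_integral_distr) (auto simp: lborel_prod)
  also have "\<dots> = (\<integral>\<^sup>+y. \<integral>\<^sup>+x. f (Complex x y) \<partial>lborel \<partial>lborel)"
    by (subst lborel_pair.nn_integral_snd[symmetric]) auto
  finally show ?thesis .
qed

lemma integral_complex:
  fixes f :: "complex \<Rightarrow> real"
  assumes f: "integrable lborel f"
  shows "(\<integral>z. f z \<partial>lborel) = (\<integral>y. \<integral>x. f (Complex x y) \<partial>lborel \<partial>lborel)"
    "integrable lborel (\<lambda>y. \<integral>x. f (Complex x y) \<partial>lborel)"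
proof -
  have [measurable]: "f \<in> borel_measurable borel" using f by auto
  have "integrable (distr (lborel :: (real \<times> real) measure) borel (\<lambda>p. Complex (fst p) (snd p))) f"
    using f by (simp flip: lborel_complex_eq)
  then have int: "integrable (lborel \<Otimes>\<^sub>M lborel) (\<lambda>(x, y). f (Complex x y))"
    by (subst (asm) integrable_distr_eq) (auto simp: lborel_prod case_prod_unfold)
  have "(\<integral>z. f z \<partial>lborel) = (\<integral>p. f (Complex (fst p) (snd p)) \<partial>(lborel \<Otimes>\<^sub>M lborel))"
    unfolding lborel_complex_eq by (subst integral_distr) (auto simp: lborel_prod)
  also have "\<dots> = (\<integral>y. \<integral>x. f (Complex x y) \<partial>lborel \<partial>lborel)"
    using lborel_pair.integral_snd[OF int] by (simp add: case_prod_unfold)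
  finally show "(\<integral>z. f z \<partial>lborel) = (\<integral>y. \<integral>x. f (Complex x y) \<partial>lborel \<partial>lborel)" .
  show "integrable lborel (\<lambda>y. \<integral>x. f (Complex x y) \<partial>lborel)"
    using lborel_pair.integrable_snd[OF int] by simp
qed

lemma nn_integral_inverse_sqrt_finite:
  assumes "N > 0"
  shows "(\<integral>\<^sup>+x. ennreal (indicator {-N..N} x * \<bar>x\<bar> powr (-1/2)) \<partial>lborel) < \<infinity>"
proof -
  have 1: "((\<lambda>x. x powr (-1/2)) has_integral (N powr (-1/2+1) / (-1/2+1))) {0..N}"
    by (rule has_integral_powr_from_0) (use assms in auto)
  then have 2: "((\<lambda>x. \<bar>x\<bar> powr (-1/2)) has_integral (N powr (-1/2+1) / (-1/2+1))) {0..N}"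
    by (rule has_integral_eq[rotated]) auto
  then have 3: "((\<lambda>x. \<bar>x\<bar> powr (-1/2)) has_integral (N powr (-1/2+1) / (-1/2+1))) {-N..0}"
    using has_integral_reflect_real[of "\<lambda>x. \<bar>x\<bar> powr (-1/2)" _ N 0] by simp
  define C where "C = N powr (-1/2+1) / (-1/2+1) + N powr (-1/2+1) / (-1/2+1)"
  have "((\<lambda>x. \<bar>x\<bar> powr (-1/2)) has_integral C) {-N..N}"
    unfolding C_def by (rule has_integral_combine[OF _ _ 3 2]) (use assms in auto)
  then have "((\<lambda>x. indicator {-N..N} x * \<bar>x\<bar> powr (-1/2)) has_integral C) UNIV"
    by (subst (asm) has_integral_restrict_UNIV[symmetric])
      (auto elim!: has_integral_eq[rotated])
  then have "(\<integral>\<^sup>+x. ennreal (indicator {-N..N} x * \<bar>x\<bar> powr (-1/2)) \<partial>lborel) = ennreal C"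
    by (intro nn_integral_has_integral_lborel) auto
  then show ?thesis by simp
qed

text \<open>Since \<open>\<bar>x\<bar> \<bar>y\<bar> \<le> x\<^sup>2 + y\<^sup>2\<close>, the kernel \<open>1 / \<bar>z\<bar>\<close> is dominated by a product of integrable functions of
  the two coordinates.\<close>

lemma nn_integral_inverse_cmod_finite:
  assumes "N > 0"
  shows "(\<integral>\<^sup>+z. ennreal (indicator (cbox (Complex (-N) (-N)) (Complex N N)) z / cmod z) \<partial>lborel) < \<infinity>"
proof -
  define h :: "real \<Rightarrow> real" where "h = (\<lambda>x. indicator {-N..N} x * \<bar>x\<bar> powr (-1/2))"
  define I where "I = (\<integral>\<^sup>+x. ennreal (h x) \<partial>lborel)"
  have [measurable]: "h \<in> borel_measurable borel" by (simp add: h_def)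
  have I: "I < \<infinity>" unfolding I_def h_def by (rule nn_integral_inverse_sqrt_finite[OF assms])
  have key: "1 / cmod (Complex x y) \<le> \<bar>x\<bar> powr (-1/2) * \<bar>y\<bar> powr (-1/2)" if "x \<noteq> 0" "y \<noteq> 0" for x y
  proof -
    have "2 * (\<bar>x\<bar> * \<bar>y\<bar>) \<le> x\<^sup>2 + y\<^sup>2"
      using sum_squares_bound[of "\<bar>x\<bar>" "\<bar>y\<bar>"] by (simp add: mult.assoc)
    moreover have "0 \<le> \<bar>x\<bar> * \<bar>y\<bar>" by simp
    ultimately have "\<bar>x\<bar> * \<bar>y\<bar> \<le> x\<^sup>2 + y\<^sup>2" by linarith
    then have le: "sqrt (\<bar>x\<bar> * \<bar>y\<bar>) \<le> cmod (Complex x y)"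
      unfolding complex_norm by (rule real_sqrt_le_mono)
    have pw: "r powr (-1/2) = 1 / sqrt r" if "r > 0" for r :: real
      using powr_minus_divide[of r "1/2"] that by (simp add: powr_half_sqrt)
    have "1 / cmod (Complex x y) \<le> 1 / sqrt (\<bar>x\<bar> * \<bar>y\<bar>)"
      by (rule frac_le) (use le that in auto)
    also have "\<dots> = \<bar>x\<bar> powr (-1/2) * \<bar>y\<bar> powr (-1/2)"
      using pw[of "\<bar>x\<bar>"] pw[of "\<bar>y\<bar>"] that by (simp add: real_sqrt_mult)
    finally show ?thesis .
  qed
  have "(\<integral>\<^sup>+z. ennreal (indicator (cbox (Complex (-N) (-N)) (Complex N N)) z / cmod z) \<partial>lborel)
      = (\<integral>\<^sup>+y. \<integral>\<^sup>+x. ennreal (indicator (cbox (Complex (-N) (-N)) (Complex N N)) (Complex x y) / cmod (Complex x y)) \<partial>lborel \<partial>lborel)"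
    by (rule nn_integral_complex) simp
  also have "\<dots> \<le> (\<integral>\<^sup>+y. \<integral>\<^sup>+x. ennreal (h x) * ennreal (h y) \<partial>lborel \<partial>lborel)"
  proof (rule nn_integral_mono_AE, rule eventually_mono[OF AE_lborel_singleton[of 0]])
    fix y :: real assume "y \<noteq> 0"
    show "(\<integral>\<^sup>+x. ennreal (indicator (cbox (Complex (-N) (-N)) (Complex N N)) (Complex x y) / cmod (Complex x y)) \<partial>lborel)
      \<le> (\<integral>\<^sup>+x. ennreal (h x) * ennreal (h y) \<partial>lborel)"
    proof (rule nn_integral_mono_AE, rule eventually_mono[OF AE_lborel_singleton[of 0]])
      fix x :: real assume "x \<noteq> 0"
      show "ennreal (indicator (cbox (Complex (-N) (-N)) (Complex N N)) (Complex x y) / cmod (Complex x y))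
        \<le> ennreal (h x) * ennreal (h y)"
        using key[OF \<open>x \<noteq> 0\<close> \<open>y \<noteq> 0\<close>]
        by (auto simp: h_def in_cbox_complex_iff indicator_def simp flip: ennreal_mult intro!: ennreal_leI)
    qed
  qed
  also have "\<dots> = I * I"
    by (simp add: nn_integral_multc nn_integral_cmult I_def)
  also have "\<dots> < \<infinity>" using I by (simp add: ennreal_mult_less_top)
  finally show ?thesis .
qed

text \<open>The bound has to be uniform in the position of the singularity, which will run along the curve.\<close>

lemma nn_integral_inverse_dist_bound:
  fixes R \<Gamma> :: "complex set"
  assumes "bounded R" "R \<in> sets borel" "bounded \<Gamma>"
  obtains C where "C < \<infinity>" "\<And>\<zeta>. \<zeta> \<in> \<Gamma> \<Longrightarrow> (\<integral>\<^sup>+z. ennreal (indicator R z / cmod (\<zeta> - z)) \<partial>lborel) \<le> C"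
proof -
  obtain r where r: "r > 0" "\<And>z. z \<in> R \<Longrightarrow> cmod z \<le> r" using assms(1) bounded_pos by blast
  obtain s where s: "s > 0" "\<And>z. z \<in> \<Gamma> \<Longrightarrow> cmod z \<le> s" using assms(3) bounded_pos by blast
  define N where "N = r + s"
  have [measurable]: "R \<in> sets borel" by fact
  show ?thesis
  proof (rule that[OF nn_integral_inverse_cmod_finite[of N]])
    show "N > 0" using r s by (simp add: N_def)
    fix \<zeta> assume "\<zeta> \<in> \<Gamma>"
    have "(\<integral>\<^sup>+z. ennreal (indicator R z / cmod (\<zeta> - z)) \<partial>lborel)
        = (\<integral>\<^sup>+z. ennreal (indicator R z / cmod (\<zeta> - z)) \<partial>(distr lborel borel ((+) \<zeta>)))"
      by (simp add: lborel_distr_plus)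
    also have "\<dots> = (\<integral>\<^sup>+z. ennreal (indicator R (\<zeta> + z) / cmod z) \<partial>lborel)"
      by (subst nn_integral_distr) auto
    also have "\<dots> \<le> (\<integral>\<^sup>+z. ennreal (indicator (cbox (Complex (-N) (-N)) (Complex N N)) z / cmod z) \<partial>lborel)"
    proof (intro nn_integral_mono ennreal_leI divide_right_mono)
      fix z
      show "indicator R (\<zeta> + z) \<le> (indicator (cbox (Complex (-N) (-N)) (Complex N N)) z :: real)"
      proof (cases "\<zeta> + z \<in> R")
        case True
        have "cmod z \<le> cmod (\<zeta> + z) + cmod \<zeta>" by (metis add_diff_cancel_left' norm_triangle_ineq4)
        then have "cmod z \<le> N" using r(2)[OF True] s(2)[OF \<open>\<zeta> \<in> \<Gamma>\<close>] by (simp add: N_def)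
        then have "\<bar>Re z\<bar> \<le> N" "\<bar>Im z\<bar> \<le> N"
          using abs_Re_le_cmod[of z] abs_Im_le_cmod[of z] by auto
        then show ?thesis by (auto simp: in_cbox_complex_iff indicator_def)
      qed auto
    qed auto
    finally show "(\<integral>\<^sup>+z. ennreal (indicator R z / cmod (\<zeta> - z)) \<partial>lborel)
      \<le> (\<integral>\<^sup>+z. ennreal (indicator (cbox (Complex (-N) (-N)) (Complex N N)) z / cmod z) \<partial>lborel)" .
  qed
qed

section \<open>The Cauchy kernel on a horizontal segment\<close>

text \<open>The kernel has the primitive \<open>- Im v / 2 \<cdot> ln \<bar>\<zeta> - z\<bar>\<^sup>2 - Re v \<cdot> arctan ((x - Re \<zeta>) / (Im \<zeta> - y))\<close> in \<open>x\<close>.\<close>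

lemma strip_kernel_slice:
  assumes "y \<noteq> Im \<zeta>" "0 \<le> n"
  shows "(\<integral>x. indicator {-n..n} x * Im (v / (\<zeta> - Complex x y)) \<partial>lborel) =
    Im v / 2 * (ln ((Re \<zeta> + n)\<^sup>2 + (Im \<zeta> - y)\<^sup>2) - ln ((Re \<zeta> - n)\<^sup>2 + (Im \<zeta> - y)\<^sup>2))
    - Re v * (arctan ((n - Re \<zeta>) / (Im \<zeta> - y)) + arctan ((n + Re \<zeta>) / (Im \<zeta> - y)))"
proof -
  define h where "h = Im \<zeta> - y"
  have h: "h \<noteq> 0" using assms by (simp add: h_def)
  have pos: "(Re \<zeta> - x)\<^sup>2 + h\<^sup>2 > 0" for x using h by (simp add: add_nonneg_pos)
  define F where "F x = - (Im v / 2) * ln ((Re \<zeta> - x)\<^sup>2 + h\<^sup>2) - Re v * arctan ((x - Re \<zeta>) / h)" for x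
  have kernel: "Im (v / (\<zeta> - Complex x y)) = (Im v * (Re \<zeta> - x) - Re v * h) / ((Re \<zeta> - x)\<^sup>2 + h\<^sup>2)" for x
    by (simp add: Im_divide h_def)
  have "(\<integral>x. indicator {-n..n} x *\<^sub>R ((Im v * (Re \<zeta> - x) - Re v * h) / ((Re \<zeta> - x)\<^sup>2 + h\<^sup>2)) \<partial>lborel)
      = F n - F (- n)"
  proof (rule integral_FTC_atLeastAtMost)
    fix x
    have at: "h * h + (x - Re \<zeta>) * (x - Re \<zeta>) \<noteq> 0" "1 + ((x - Re \<zeta>) / h)\<^sup>2 = ((Re \<zeta> - x)\<^sup>2 + h\<^sup>2) / h\<^sup>2"
      using pos[of x] h by (simp_all add: power2_eq_square field_simps)
    have "(F has_real_derivative (- (Im v / 2) * (2 * (Re \<zeta> - x) * (- 1) / ((Re \<zeta> - x)\<^sup>2 + h\<^sup>2))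
        - Re v * ((1 / h) / (1 + ((x - Re \<zeta>) / h)\<^sup>2)))) (at x)"
      unfolding F_def using pos[of x] h by (auto intro!: derivative_eq_intros simp: field_simps)
    moreover have "- (Im v / 2) * (2 * A * (- 1) / D) - Re v * ((1 / h) / (D / h\<^sup>2)) = (Im v * A - Re v * h) / D"
      if "D > 0" for A D
      using h that by (simp add: field_simps power2_eq_square)
    from this[OF pos] have "(- (Im v / 2) * (2 * (Re \<zeta> - x) * (- 1) / ((Re \<zeta> - x)\<^sup>2 + h\<^sup>2))
        - Re v * ((1 / h) / (1 + ((x - Re \<zeta>) / h)\<^sup>2)))
        = (Im v * (Re \<zeta> - x) - Re v * h) / ((Re \<zeta> - x)\<^sup>2 + h\<^sup>2)"
      unfolding at(2) .
    ultimately show "(F has_vector_derivative (Im v * (Re \<zeta> - x) - Re v * h) / ((Re \<zeta> - x)\<^sup>2 + h\<^sup>2)) (at x within {-n..n})"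
      by (simp add: has_real_derivative_iff_has_vector_derivative has_vector_derivative_at_within)
  next
    show "continuous_on {- n..n} (\<lambda>x. (Im v * (Re \<zeta> - x) - Re v * h) / ((Re \<zeta> - x)\<^sup>2 + h\<^sup>2))"
      using pos by (intro continuous_intros) (metis less_irrefl)
  qed (use assms in auto)
  moreover have "arctan ((- n - Re \<zeta>) / h) = - arctan ((n + Re \<zeta>) / h)"
    using arctan_minus[of "(n + Re \<zeta>) / h"] by (simp add: minus_divide_left del: arctan_minus)
  ultimately show ?thesis
    by (simp add: kernel F_def algebra_simps flip: h_def)
qed

text \<open>A bound independent of \<open>n\<close>, \<open>y\<close> and \<open>\<zeta>\<close>, as dominated convergence needs it.  Once the segment is at least four times
  as long as \<open>\<bar>Re \<zeta>\<bar>\<close>, the squared distances from \<open>\<zeta>\<close> to its two ends differ at most by the factor \<open>9\<close>.\<close>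

lemma strip_kernel_slice_bound:
  assumes "y \<noteq> Im \<zeta>" "2 * \<bar>Re \<zeta>\<bar> \<le> n"
  shows "\<bar>\<integral>x. indicator {-n..n} x * Im (v / (\<zeta> - Complex x y)) \<partial>lborel\<bar> \<le> (ln 9 + pi) * cmod v"
proof -
  define h where "h = Im \<zeta> - y"
  have h: "h \<noteq> 0" using assms by (simp add: h_def)
  have pos: "(Re \<zeta> - x)\<^sup>2 + h\<^sup>2 > 0" "(Re \<zeta> + x)\<^sup>2 + h\<^sup>2 > 0" for x using h by (simp_all add: add_nonneg_pos)
  have le: "(Re \<zeta> + n)\<^sup>2 + h\<^sup>2 \<le> 9 * ((Re \<zeta> - n)\<^sup>2 + h\<^sup>2)" "(Re \<zeta> - n)\<^sup>2 + h\<^sup>2 \<le> 9 * ((Re \<zeta> + n)\<^sup>2 + h\<^sup>2)"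
  proof -
    have "\<bar>Re \<zeta> + n\<bar> \<le> \<bar>3 * (Re \<zeta> - n)\<bar>" "\<bar>Re \<zeta> - n\<bar> \<le> \<bar>3 * (Re \<zeta> + n)\<bar>" using assms(2) by (auto simp: abs_if split: if_splits)
    then have "(Re \<zeta> + n)\<^sup>2 \<le> (3 * (Re \<zeta> - n))\<^sup>2" "(Re \<zeta> - n)\<^sup>2 \<le> (3 * (Re \<zeta> + n))\<^sup>2"
      by (simp_all add: abs_le_square_iff)
    moreover have "(3 * r)\<^sup>2 = 9 * r\<^sup>2" for r :: real
      unfolding power_mult_distrib by simp
    ultimately have "(Re \<zeta> + n)\<^sup>2 \<le> 9 * (Re \<zeta> - n)\<^sup>2" "(Re \<zeta> - n)\<^sup>2 \<le> 9 * (Re \<zeta> + n)\<^sup>2"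
      by metis+
    then show "(Re \<zeta> + n)\<^sup>2 + h\<^sup>2 \<le> 9 * ((Re \<zeta> - n)\<^sup>2 + h\<^sup>2)" "(Re \<zeta> - n)\<^sup>2 + h\<^sup>2 \<le> 9 * ((Re \<zeta> + n)\<^sup>2 + h\<^sup>2)"
      using zero_le_power2[of h] by (simp_all only: distrib_left)
  qed
  have "ln ((Re \<zeta> + n)\<^sup>2 + h\<^sup>2) \<le> ln (9 * ((Re \<zeta> - n)\<^sup>2 + h\<^sup>2))"
    "ln ((Re \<zeta> - n)\<^sup>2 + h\<^sup>2) \<le> ln (9 * ((Re \<zeta> + n)\<^sup>2 + h\<^sup>2))"
    using le pos by (simp_all add: ln_mono)
  then have "\<bar>ln ((Re \<zeta> + n)\<^sup>2 + h\<^sup>2) - ln ((Re \<zeta> - n)\<^sup>2 + h\<^sup>2)\<bar> \<le> ln 9"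
    using pos[of n] ln_mult_pos[of 9 "(Re \<zeta> - n)\<^sup>2 + h\<^sup>2"] ln_mult_pos[of 9 "(Re \<zeta> + n)\<^sup>2 + h\<^sup>2"]
    by (simp only: abs_le_iff) simp
  then have 1: "\<bar>Im v / 2 * (ln ((Re \<zeta> + n)\<^sup>2 + h\<^sup>2) - ln ((Re \<zeta> - n)\<^sup>2 + h\<^sup>2))\<bar> \<le> cmod v * ln 9"
    unfolding abs_mult using abs_Im_le_cmod[of v] by (intro mult_mono) auto
  have "\<bar>arctan ((n - Re \<zeta>) / h) + arctan ((n + Re \<zeta>) / h)\<bar> \<le> pi"
    using arctan_bounded[of "(n - Re \<zeta>) / h"] arctan_bounded[of "(n + Re \<zeta>) / h"] by linarith
  then have 2: "\<bar>Re v * (arctan ((n - Re \<zeta>) / h) + arctan ((n + Re \<zeta>) / h))\<bar> \<le> cmod v * pi"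
    unfolding abs_mult using abs_Re_le_cmod[of v] by (intro mult_mono) auto
  have "0 \<le> n" using assms(2) by linarith
  show ?thesis
    unfolding strip_kernel_slice[OF assms(1) \<open>0 \<le> n\<close>] h_def[symmetric]
    using 1 2 by (simp add: algebra_simps)
qed

text \<open>The logarithms at the two ends of the segment cancel in the limit, and the arcus tangens terms add up
  to the half-turn under which the full line is seen from \<open>\<zeta>\<close>.\<close>

lemma strip_kernel_slice_limit:
  assumes "y \<noteq> Im \<zeta>"
  shows "((\<lambda>n. \<integral>x. indicator {-n..n} x * Im (v / (\<zeta> - Complex x y)) \<partial>lborel)
     \<longlongrightarrow> - pi * Re v * sgn (Im \<zeta> - y)) at_top"
proof -
  define h where "h = Im \<zeta> - y"
  define \<xi> where "\<xi> = Re \<zeta>"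
  have h: "h \<noteq> 0" using assms by (simp add: h_def)
  have 1: "((\<lambda>n. ln ((\<xi> + n)\<^sup>2 + h\<^sup>2) - ln ((\<xi> - n)\<^sup>2 + h\<^sup>2)) \<longlongrightarrow> 0) at_top"
    by real_asymp
  have 2: "((\<lambda>n. arctan ((n - \<xi>) / h) + arctan ((n + \<xi>) / h)) \<longlongrightarrow> pi * sgn h) at_top"
  proof (cases "h > 0")
    case True
    then show ?thesis by simp real_asymp
  next
    case False
    then have "h < 0" using h by simp
    then show ?thesis by simp real_asymp
  qed
  have "((\<lambda>n. Im v / 2 * (ln ((\<xi> + n)\<^sup>2 + h\<^sup>2) - ln ((\<xi> - n)\<^sup>2 + h\<^sup>2))
      - Re v * (arctan ((n - \<xi>) / h) + arctan ((n + \<xi>) / h))) \<longlongrightarrow> Im v / 2 * 0 - Re v * (pi * sgn h)) at_top"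
    by (intro tendsto_intros 1 2)
  then have lim: "((\<lambda>n. Im v / 2 * (ln ((\<xi> + n)\<^sup>2 + h\<^sup>2) - ln ((\<xi> - n)\<^sup>2 + h\<^sup>2))
      - Re v * (arctan ((n - \<xi>) / h) + arctan ((n + \<xi>) / h))) \<longlongrightarrow> - pi * Re v * sgn (Im \<zeta> - y)) at_top"
    by (simp add: h_def algebra_simps)
  show ?thesis
    by (rule Lim_transform_eventually[OF lim])
      (use eventually_ge_at_top[of 0] in eventually_elim, simp add: strip_kernel_slice[OF assms] h_def \<xi>_def)
qed

section \<open>Weighted integrals of a winding number\<close>

context closed_C1_curve
begin

lemma valid_path: "valid_path c"
proof -
  have "c C1_differentiable_on {0..1}"
    unfolding C1_differentiable_on_def using has_deriv continuous_on_subset[OF cont_deriv] by blast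
  then show ?thesis by (simp add: valid_path_def C1_differentiable_imp_piecewise)
qed

lemma measurable_curve [measurable]:
  "c \<in> borel_measurable borel" "c' \<in> borel_measurable borel"
  by (auto intro!: borel_measurable_continuous_onI cont cont_deriv)

lemma has_integral_Re_winding_number:
  assumes z: "z \<notin> path_image c"
  shows "((\<lambda>u. Im (c' u / (c u - z))) has_integral 2 * pi * Re (winding_number c z)) {0..1}"
proof -
  have "((\<lambda>w. 1 / (w - z)) has_contour_integral (2 * pi * \<i> * winding_number c z)) c"
    by (rule has_contour_integral_winding_number[OF valid_path z])
  then have "((\<lambda>u. 1 / (c u - z) * vector_derivative c (at u within {0..1})) has_integral
      (2 * pi * \<i> * winding_number c z)) {0..1}"
    by (simp add: has_contour_integral_def)
  moreover have "vector_derivative c (at u within {0..1}) = c' u" if "u \<in> {0..1}" for u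
    using that by (intro vector_derivative_at_within_ivl has_deriv) auto
  ultimately have "((\<lambda>u. c' u / (c u - z)) has_integral (2 * pi * \<i> * winding_number c z)) {0..1}"
    by (elim has_integral_eq[rotated]) auto
  then have "((\<lambda>u. Im (c' u / (c u - z))) has_integral Im (2 * pi * \<i> * winding_number c z)) {0..1}"
    by (rule has_integral_Im)
  then show ?thesis by simp
qed

lemma Re_winding_number:
  assumes z: "z \<notin> path_image c"
  shows "2 * pi * Re (winding_number c z) = (\<integral>u. indicator {0..1} u * Im (c' u / (c u - z)) \<partial>lborel)"
proof -
  have "continuous_on {0..1} (\<lambda>u. Im (c' u / (c u - z)))"
    using z by (auto simp: path_image_def intro!: continuous_intros cont continuous_on_subset[OF cont_deriv])
  then have "set_integrable lborel {0..1} (\<lambda>u. Im (c' u / (c u - z)))"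
    by (rule borel_integrable_atLeastAtMost')
  from set_borel_integral_eq_integral(2)[OF this] show ?thesis
    using has_integral_Re_winding_number[OF z] by (simp add: set_lebesgue_integral_def integral_unique)
qed

text \<open>The Cauchy integral represents the winding number only off the curve; this exception does not affect
  area integrals.\<close>

lemma path_image_null: "AE z in lborel. z \<notin> path_image c"
proof -
  have "negligible (c ` {0..1})"
    by (rule negligible_differentiable_image_lowdim)
      (use has_deriv in \<open>auto intro!: differentiable_at_imp_differentiable_on differentiableI_vector\<close>)
  then have "c ` {0..1} \<in> null_sets lebesgue" by (simp add: negligible_iff_null_sets)
  moreover have "closed (c ` {0..1})"
    by (intro compact_imp_closed compact_continuous_image cont) auto
  ultimately have "c ` {0..1} \<in> null_sets lborel"
    by (auto simp: null_sets_def)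
  then show ?thesis unfolding path_image_def by (rule AE_not_in)
qed

text \<open>The singularity of \<open>1 / (c u - z)\<close> is integrable in the plane, and uniformly so along the curve.\<close>

lemma integrable_winding_kernel:
  assumes [measurable]: "\<rho> \<in> borel_measurable borel" and D: "\<And>z. \<bar>\<rho> z\<bar> \<le> D * indicator R z"
    and [measurable]: "R \<in> sets borel" and "bounded R"
  shows "integrable (lborel \<Otimes>\<^sub>M lborel) (\<lambda>(u, z). indicator {0..1} u * (\<rho> z * Im (c' u / (c u - z))))"
    and "\<And>u. integrable lborel (\<lambda>z. \<rho> z * Im (c' u / (c u - z)))"
proof -
  have key: "\<bar>\<rho> z * Im (c' u / (c u - z))\<bar> \<le> D * cmod (c' u) * (indicator R z / cmod (c u - z))" for u z
  proof -
    have "\<bar>\<rho> z\<bar> * \<bar>Im (c' u / (c u - z))\<bar> \<le> (D * indicator R z) * (cmod (c' u) / cmod (c u - z))"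
      using D[of z] abs_Im_le_cmod[of "c' u / (c u - z)"]
      by (intro mult_mono) (auto simp: norm_divide intro: order_trans[OF abs_ge_zero])
    then show ?thesis by (simp add: abs_mult mult_ac)
  qed
  have D0: "D * indicator R z \<ge> 0" for z using D[of z] by linarith
  have E: "(\<integral>\<^sup>+z. ennreal \<bar>\<rho> z * Im (c' u / (c u - z))\<bar> \<partial>lborel)
      \<le> ennreal (\<bar>D\<bar> * cmod (c' u)) * (\<integral>\<^sup>+z. ennreal (indicator R z / cmod (c u - z)) \<partial>lborel)" for u
  proof -
    have "(\<integral>\<^sup>+z. ennreal \<bar>\<rho> z * Im (c' u / (c u - z))\<bar> \<partial>lborel)
      \<le> (\<integral>\<^sup>+z. ennreal (\<bar>D\<bar> * cmod (c' u)) * ennreal (indicator R z / cmod (c u - z)) \<partial>lborel)"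
    proof (rule nn_integral_mono)
      fix z
      have "D * cmod (c' u) * (indicator R z / cmod (c u - z)) \<le> \<bar>D\<bar> * cmod (c' u) * (indicator R z / cmod (c u - z))"
        by (intro mult_right_mono) auto
      with key[of z u] show "ennreal \<bar>\<rho> z * Im (c' u / (c u - z))\<bar>
          \<le> ennreal (\<bar>D\<bar> * cmod (c' u)) * ennreal (indicator R z / cmod (c u - z))"
        by (subst ennreal_mult[symmetric]) (auto intro!: ennreal_leI)
    qed
    also have "\<dots> = ennreal (\<bar>D\<bar> * cmod (c' u)) * (\<integral>\<^sup>+z. ennreal (indicator R z / cmod (c u - z)) \<partial>lborel)"
      by (rule nn_integral_cmult) auto
    finally show ?thesis .
  qed
  show "integrable lborel (\<lambda>z. \<rho> z * Im (c' u / (c u - z)))" for u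
  proof (rule integrableI_bounded)
    obtain C where C: "C < \<infinity>" "\<And>\<zeta>. \<zeta> \<in> {c u} \<Longrightarrow> (\<integral>\<^sup>+z. ennreal (indicator R z / cmod (\<zeta> - z)) \<partial>lborel) \<le> C"
      using nn_integral_inverse_dist_bound[OF \<open>bounded R\<close> \<open>R \<in> sets borel\<close> finite_imp_bounded[of "{c u}"]] by auto
    then have "(\<integral>\<^sup>+z. ennreal \<bar>\<rho> z * Im (c' u / (c u - z))\<bar> \<partial>lborel) \<le> ennreal (\<bar>D\<bar> * cmod (c' u)) * C"
      by (intro order_trans[OF E] mult_left_mono) auto
    also have "\<dots> < \<infinity>" using C(1) by (simp add: ennreal_mult_less_top)
    finally show "(\<integral>\<^sup>+z. ennreal (norm (\<rho> z * Im (c' u / (c u - z)))) \<partial>lborel) < \<infinity>" by simp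
  qed auto
  show "integrable (lborel \<Otimes>\<^sub>M lborel) (\<lambda>(u, z). indicator {0..1} u * (\<rho> z * Im (c' u / (c u - z))))"
  proof (rule integrableI_bounded)
    have "bounded (c ` {0..1})" "bounded (c' ` {0..1})"
      by (auto intro!: compact_imp_bounded compact_continuous_image cont continuous_on_subset[OF cont_deriv])
    then obtain C where C: "C < \<infinity>" "\<And>\<zeta>. \<zeta> \<in> c ` {0..1} \<Longrightarrow> (\<integral>\<^sup>+z. ennreal (indicator R z / cmod (\<zeta> - z)) \<partial>lborel) \<le> C"
      using nn_integral_inverse_dist_bound[OF \<open>bounded R\<close> \<open>R \<in> sets borel\<close>] by blast
    obtain M where M: "\<And>v. v \<in> c' ` {0..1} \<Longrightarrow> cmod v \<le> M"
      using \<open>bounded (c' ` {0..1})\<close> unfolding bounded_iff by blast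
    have "(\<integral>\<^sup>+(u, z). ennreal (norm (indicator {0..1} u * (\<rho> z * Im (c' u / (c u - z))))) \<partial>(lborel \<Otimes>\<^sub>M lborel))
        = (\<integral>\<^sup>+u. \<integral>\<^sup>+z. ennreal (norm (indicator {0..1} u * (\<rho> z * Im (c' u / (c u - z))))) \<partial>lborel \<partial>lborel)"
      by (subst lborel.nn_integral_fst[symmetric]) auto
    also have "\<dots> \<le> (\<integral>\<^sup>+u. ennreal (\<bar>D\<bar> * M) * C * indicator {0..1::real} u \<partial>lborel)"
    proof (rule nn_integral_mono)
      fix u :: real
      show "(\<integral>\<^sup>+z. ennreal (norm (indicator {0..1} u * (\<rho> z * Im (c' u / (c u - z))))) \<partial>lborel)
        \<le> ennreal (\<bar>D\<bar> * M) * C * indicator {0..1::real} u"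
      proof (cases "u \<in> {0..1}")
        case True
        have "(\<integral>\<^sup>+z. ennreal \<bar>\<rho> z * Im (c' u / (c u - z))\<bar> \<partial>lborel) \<le> ennreal (\<bar>D\<bar> * M) * C"
          using M[of "c' u"] C(2)[of "c u"] True
          by (intro order_trans[OF E] mult_mono ennreal_leI) auto
        then show ?thesis using True by simp
      qed auto
    qed
    also have "\<dots> = ennreal (\<bar>D\<bar> * M) * C"
      by (subst nn_integral_cmult_indicator) auto
    also have "\<dots> < \<infinity>" using C(1) by (simp add: ennreal_mult_less_top)
    finally show "(\<integral>\<^sup>+p. ennreal (norm (case p of (u, z) \<Rightarrow> indicator {0..1} u * (\<rho> z * Im (c' u / (c u - z))))) \<partial>(lborel \<Otimes>\<^sub>M lborel)) < \<infinity>"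
      by (simp add: case_prod_unfold)
  qed auto
qed

text \<open>The Cauchy integral expresses \<open>winding_number c z\<close> through the kernel \<open>c' u / (c u - z)\<close>; the kernel is
  integrable in \<open>(u, z)\<close> jointly, so Fubini's theorem applies.  The function \<open>W\<close> stands for a measurable
  version of the winding number.\<close>

lemma weighted_integral_winding_number:
  assumes [measurable]: "\<rho> \<in> borel_measurable borel" and D: "\<And>z. \<bar>\<rho> z\<bar> \<le> D * indicator R z"
    and [measurable]: "R \<in> sets borel" and "bounded R"
    and [measurable]: "W \<in> borel_measurable borel"
    and W: "\<And>z. z \<notin> path_image c \<Longrightarrow> W z = Re (winding_number c z)"
  shows "2 * pi * (\<integral>z. \<rho> z * W z \<partial>lborel) =
     (\<integral>u. indicator {0..1} u * (\<integral>z. \<rho> z * Im (c' u / (c u - z)) \<partial>lborel) \<partial>lborel)"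
proof -
  note int = integrable_winding_kernel(1)[OF assms(1-4)]
  have "(\<integral>u. indicator {0..1} u * (\<integral>z. \<rho> z * Im (c' u / (c u - z)) \<partial>lborel) \<partial>lborel)
      = (\<integral>u. \<integral>z. indicator {0..1} u * (\<rho> z * Im (c' u / (c u - z))) \<partial>lborel \<partial>lborel)"
    by simp
  also have "\<dots> = (\<integral>z. \<integral>u. indicator {0..1} u * (\<rho> z * Im (c' u / (c u - z))) \<partial>lborel \<partial>lborel)"
    by (rule lborel_pair.Fubini_integral[symmetric]) (use int in simp)
  also have "\<dots> = (\<integral>z. 2 * pi * (\<rho> z * W z) \<partial>lborel)"
  proof (rule integral_cong_AE)
    show "(\<lambda>z. \<integral>u. indicator {0..1} u * (\<rho> z * Im (c' u / (c u - z))) \<partial>lborel) \<in> borel_measurable lborel"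
      by measurable
    show "AE z in lborel. (\<integral>u. indicator {0..1} u * (\<rho> z * Im (c' u / (c u - z))) \<partial>lborel) = 2 * pi * (\<rho> z * W z)"
      using path_image_null
    proof eventually_elim
      fix z assume z: "z \<notin> path_image c"
      have "(\<integral>u. indicator {0..1} u * (\<rho> z * Im (c' u / (c u - z))) \<partial>lborel)
          = \<rho> z * (\<integral>u. indicator {0..1} u * Im (c' u / (c u - z)) \<partial>lborel)"
        by (simp add: mult.left_commute)
      then show "(\<integral>u. indicator {0..1} u * (\<rho> z * Im (c' u / (c u - z))) \<partial>lborel) = 2 * pi * (\<rho> z * W z)"
        by (simp add: W[OF z] flip: Re_winding_number[OF z])
    qed
  qed auto
  also have "\<dots> = 2 * pi * (\<integral>z. \<rho> z * W z \<partial>lborel)" by simp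
  finally show ?thesis by simp
qed

end

section \<open>Hyperbolic area as a line integral\<close>

lemma integral_inverse_square:
  fixes a b :: real
  assumes "0 < a" "a \<le> b"
  shows "(\<integral>y. indicator {a..b} y *\<^sub>R (1 / y\<^sup>2) \<partial>lborel) = 1 / a - 1 / b"
proof -
  have "(\<integral>y. indicator {a..b} y *\<^sub>R (1 / y\<^sup>2) \<partial>lborel) = - (1 / b) - - (1 / a)"
  proof (rule integral_FTC_atLeastAtMost)
    fix y assume "a \<le> y"
    then have "((\<lambda>y. - (1 / y)) has_real_derivative 1 / y\<^sup>2) (at y)"
      using \<open>0 < a\<close> by (auto intro!: derivative_eq_intros simp: power2_eq_square)
    then show "((\<lambda>y. - (1 / y)) has_vector_derivative 1 / y\<^sup>2) (at y within {a..b})"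
      by (simp add: has_real_derivative_iff_has_vector_derivative has_vector_derivative_at_within)
  qed (use assms in \<open>auto intro!: continuous_intros\<close>)
  then show ?thesis by simp
qed

lemma integrable_inverse_square:
  fixes a b :: real
  assumes "0 < a"
  shows "integrable lborel (\<lambda>y. indicator {a..b} y *\<^sub>R (1 / y\<^sup>2))"
proof -
  have "continuous_on {a..b} (\<lambda>y. 1 / y\<^sup>2)"
    using assms by (auto intro!: continuous_intros)
  then show ?thesis
    using borel_integrable_atLeastAtMost' unfolding set_integrable_def by blast
qed

lemma integral_sgn_inverse_square:
  fixes a b \<eta> :: real
  assumes "0 < a" "a \<le> \<eta>" "\<eta> \<le> b"
  shows "(\<integral>y. indicator {a..b} y / y\<^sup>2 * sgn (\<eta> - y) \<partial>lborel) = 1 / a + 1 / b - 2 / \<eta>"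
proof -
  have "indicator {a..b} y / y\<^sup>2 * sgn (\<eta> - y)
      = indicator {a..\<eta>} y *\<^sub>R (1 / y\<^sup>2) - indicator {\<eta>..b} y *\<^sub>R (1 / y\<^sup>2)" for y
    using assms by (auto simp: indicator_def sgn_if)
  then show ?thesis
    using assms integrable_inverse_square[of a \<eta>] integrable_inverse_square[of \<eta> b]
      integral_inverse_square[of a \<eta>] integral_inverse_square[of \<eta> b]
    by (simp add: Bochner_Integration.integral_diff)
qed

text \<open>The density of the hyperbolic area on the rectangle \<open>[- n, n] \<times> [a, b]\<close>, outside which it is cut off to
  make the Cauchy kernel integrable.\<close>

definition strip_density :: "real \<Rightarrow> real \<Rightarrow> real \<Rightarrow> complex \<Rightarrow> real" where
  "strip_density a b n z = indicator (cbox (Complex (- n) a) (Complex n b)) z / (Im z)\<^sup>2"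

lemma measurable_strip_density [measurable]: "strip_density a b n \<in> borel_measurable borel"
  unfolding strip_density_def by measurable

lemma strip_density_bound:
  assumes "0 < a"
  shows "\<bar>strip_density a b n z\<bar> \<le> 1 / a\<^sup>2 * indicator (cbox (Complex (- n) a) (Complex n b)) z"
proof (cases "z \<in> cbox (Complex (- n) a) (Complex n b)")
  case True
  then have "a \<le> Im z" by (simp add: in_cbox_complex_iff)
  then have "1 / (Im z)\<^sup>2 \<le> 1 / a\<^sup>2" using assms by (intro divide_left_mono power_mono) auto
  then show ?thesis using True by (simp add: strip_density_def)
qed (simp add: strip_density_def)

context closed_C1_curve
begin

text \<open>The inner integral that remains when the winding number, weighted with the density of the rectangle, is
  integrated first over the rectangle and then along the curve.\<close>

definition strip_potential :: "real \<Rightarrow> real \<Rightarrow> real \<Rightarrow> real \<Rightarrow> real" where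
  "strip_potential a b n u = (\<integral>z. strip_density a b n z * Im (c' u / (c u - z)) \<partial>lborel)"

lemma integrable_strip_kernel:
  assumes "0 < a"
  shows "integrable lborel (\<lambda>z. strip_density a b n z * Im (c' u / (c u - z)))"
  by (rule integrable_winding_kernel(2)[OF measurable_strip_density strip_density_bound[OF assms]]) auto

lemma strip_potential_iterated:
  assumes "0 < a"
  shows "strip_potential a b n u = (\<integral>y. indicator {a..b} y / y\<^sup>2 *
      (\<integral>x. indicator {-n..n} x * Im (c' u / (c u - Complex x y)) \<partial>lborel) \<partial>lborel)"
proof -
  have split: "strip_density a b n (Complex x y) * k = indicator {a..b} y / y\<^sup>2 * (indicator {-n..n} x * k)" for x y k
    by (auto simp: strip_density_def in_cbox_complex_iff indicator_def)
  show ?thesis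
    unfolding strip_potential_def integral_complex(1)[OF integrable_strip_kernel[OF assms]] split
    by simp
qed

lemma strip_potential_bound:
  assumes "0 < a" "a \<le> b" "2 * \<bar>Re (c u)\<bar> \<le> n"
  shows "\<bar>strip_potential a b n u\<bar> \<le> (1 / a - 1 / b) * ((ln 9 + pi) * cmod (c' u))"
proof -
  define X where "X y = (\<integral>x. indicator {-n..n} x * Im (c' u / (c u - Complex x y)) \<partial>lborel)" for y
  have eq: "strip_density a b n (Complex x y) * k = indicator {a..b} y / y\<^sup>2 * (indicator {-n..n} x * k)" for x y k
    by (auto simp: strip_density_def in_cbox_complex_iff indicator_def)
  have int: "integrable lborel (\<lambda>y. indicator {a..b} y / y\<^sup>2 * X y)"
    using integral_complex(2)[OF integrable_strip_kernel[OF assms(1), of b n u]]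
    by (simp add: eq X_def)
  have "\<bar>strip_potential a b n u\<bar> \<le> (\<integral>y. \<bar>indicator {a..b} y / y\<^sup>2 * X y\<bar> \<partial>lborel)"
    unfolding strip_potential_iterated[OF assms(1)] X_def[symmetric] by (rule integral_abs_bound)
  also have "\<dots> \<le> (\<integral>y. indicator {a..b} y *\<^sub>R (1 / y\<^sup>2) * ((ln 9 + pi) * cmod (c' u)) \<partial>lborel)"
  proof (rule integral_mono_AE)
    show "AE y in lborel. \<bar>indicator {a..b} y / y\<^sup>2 * X y\<bar>
        \<le> indicator {a..b} y *\<^sub>R (1 / y\<^sup>2) * ((ln 9 + pi) * cmod (c' u))"
      using AE_lborel_singleton[of "Im (c u)"]
    proof eventually_elim
      fix y assume "y \<noteq> Im (c u)"
      then have "\<bar>X y\<bar> \<le> (ln 9 + pi) * cmod (c' u)"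
        unfolding X_def using assms(3) by (rule strip_kernel_slice_bound)
      then show "\<bar>indicator {a..b} y / y\<^sup>2 * X y\<bar>
        \<le> indicator {a..b} y *\<^sub>R (1 / y\<^sup>2) * ((ln 9 + pi) * cmod (c' u))"
        unfolding abs_mult by (auto intro!: mult_mono simp: indicator_def divide_simps)
    qed
  qed (intro integrable_abs int integrable_mult_left integrable_inverse_square assms(1))+
  also have "\<dots> = (1 / a - 1 / b) * ((ln 9 + pi) * cmod (c' u))"
    unfolding integral_mult_left_zero integral_inverse_square[OF assms(1,2)] ..
  finally show ?thesis .
qed

text \<open>In the limit of long rectangles, the horizontal integral of the kernel only sees whether a line lies
  above or below the point \<open>c u\<close>.\<close>

lemma strip_potential_limit:
  assumes "0 < a" "a \<le> Im (c u)" "Im (c u) \<le> b"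
  shows "((\<lambda>n. strip_potential a b n u) \<longlongrightarrow> pi * Re (c' u) * (2 / Im (c u) - 1 / a - 1 / b)) at_top"
proof -
  define X where "X n y = (\<integral>x. indicator {-n..n} x * Im (c' u / (c u - Complex x y)) \<partial>lborel)" for n y
  define w where "w y = indicator {a..b} y *\<^sub>R (1 / y\<^sup>2) * ((ln 9 + pi) * cmod (c' u))" for y
  have [measurable]: "X n \<in> borel_measurable borel" for n
    unfolding X_def by measurable
  have "((\<lambda>n. \<integral>y. indicator {a..b} y / y\<^sup>2 * X n y \<partial>lborel)
      \<longlongrightarrow> (\<integral>y. indicator {a..b} y / y\<^sup>2 * (- pi * Re (c' u) * sgn (Im (c u) - y)) \<partial>lborel)) at_top"
  proof (rule integral_dominated_convergence_at_top[where w = w])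
    show "AE y in lborel. ((\<lambda>n. indicator {a..b} y / y\<^sup>2 * X n y)
        \<longlongrightarrow> indicator {a..b} y / y\<^sup>2 * (- pi * Re (c' u) * sgn (Im (c u) - y))) at_top"
      using AE_lborel_singleton[of "Im (c u)"]
      by eventually_elim (unfold X_def, intro tendsto_mult_left strip_kernel_slice_limit)
    show "\<forall>\<^sub>F n in at_top. AE y in lborel. norm (indicator {a..b} y / y\<^sup>2 * X n y) \<le> w y"
      using eventually_ge_at_top[of "2 * \<bar>Re (c u)\<bar>"]
    proof eventually_elim
      fix n assume n: "2 * \<bar>Re (c u)\<bar> \<le> n"
      show "AE y in lborel. norm (indicator {a..b} y / y\<^sup>2 * X n y) \<le> w y"
        using AE_lborel_singleton[of "Im (c u)"]
      proof eventually_elim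
        fix y assume "y \<noteq> Im (c u)"
        then have "\<bar>X n y\<bar> \<le> (ln 9 + pi) * cmod (c' u)"
          unfolding X_def using n by (rule strip_kernel_slice_bound)
        then show "norm (indicator {a..b} y / y\<^sup>2 * X n y) \<le> w y"
          unfolding norm_mult w_def by (auto intro!: mult_mono simp: indicator_def divide_simps)
      qed
    qed
    show "integrable lborel w"
      unfolding w_def by (intro integrable_mult_left integrable_inverse_square assms(1))
  qed auto
  moreover have "(\<integral>y. indicator {a..b} y / y\<^sup>2 * (- pi * Re (c' u) * sgn (Im (c u) - y)) \<partial>lborel)
      = - pi * Re (c' u) * (\<integral>y. indicator {a..b} y / y\<^sup>2 * sgn (Im (c u) - y) \<partial>lborel)"
    by (subst integral_mult_right_zero[symmetric]) (simp add: mult_ac)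
  ultimately show ?thesis
    unfolding strip_potential_iterated[OF assms(1)] X_def[symmetric]
      integral_sgn_inverse_square[OF assms] by (simp add: algebra_simps)
qed

text \<open>Green's formula for the one-form \<open>dx / y\<close>.  In the limit of \<open>strip_potential_limit\<close> the terms
  \<open>1 / a\<close> and \<open>1 / r\<close> drop out because \<open>Re c'\<close> integrates to \<open>0\<close> over a period.\<close>

theorem enclosed_area_eq_line_integral:
  assumes upper: "\<And>u. 0 < Im (c u)"
    and wind: "\<And>z. z \<in> inside (path_image c) \<Longrightarrow> winding_number c z = of_real \<epsilon>"
  shows "\<epsilon> * enclosed_area c = integral {0..1} (\<lambda>u. Re (c' u) / Im (c u))"
proof -
  define S where "S = inside (path_image c)"
  have "compact (path_image c)" using path by (rule compact_path_image)
  then have "open S" unfolding S_def by (simp add: open_inside compact_imp_closed)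
  then have [measurable]: "S \<in> sets borel" by simp
  obtain r where r: "\<And>z. z \<in> path_image c \<Longrightarrow> cmod z \<le> r"
    using compact_imp_bounded[OF \<open>compact (path_image c)\<close>] unfolding bounded_iff by blast
  have "continuous_on (path_image c) Im" by (intro continuous_intros)
  then obtain z0 where z0: "z0 \<in> path_image c" "\<And>z. z \<in> path_image c \<Longrightarrow> Im z0 \<le> Im z"
    using continuous_attains_inf[OF \<open>compact (path_image c)\<close> path_image_nonempty] by blast
  define a where "a = Im z0"
  have a: "0 < a" using z0(1) upper by (auto simp: a_def path_image_def)
  have on: "c u \<in> path_image c" if "u \<in> {0..1}" for u using that by (auto simp: path_image_def)
  have box: "path_image c \<subseteq> cbox (Complex (- n) a) (Complex n r)" if "r \<le> n" for n
  proof
    fix z assume z: "z \<in> path_image c"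
    show "z \<in> cbox (Complex (- n) a) (Complex n r)"
      using z0(2)[OF z] r[OF z] that abs_Re_le_cmod[of z] abs_Im_le_cmod[of z]
      by (auto simp: in_cbox_complex_iff a_def)
  qed
  have S_box: "S \<subseteq> cbox (Complex (- n) a) (Complex n r)" if "r \<le> n" for n
    using outside_subset_convex[OF convex_box(1) box[OF that]] inside_Int_outside
    unfolding S_def by blast
  have S_upper: "Im z > 0" if "z \<in> S" for z
    using that S_box[of r] a by (auto simp: in_cbox_complex_iff)
  define W where "W z = \<epsilon> * indicator S z" for z
  have [measurable]: "W \<in> borel_measurable borel" unfolding W_def by measurable
  have W: "W z = Re (winding_number c z)" if "z \<notin> path_image c" for z
  proof (cases "z \<in> S")
    case True
    then show ?thesis using wind by (simp add: W_def S_def)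
  next
    case False
    then have "z \<in> outside (path_image c)" using that inside_Un_outside unfolding S_def by blast
    then show ?thesis using False winding_number_zero_in_outside[OF path pathfinish] by (simp add: W_def)
  qed
  have "enclosed_area c = (\<integral>z. indicator S z \<partial>hyp_area_measure)"
    by (simp add: enclosed_area_def S_def hyp_area_measure_def)
  also have "\<dots> = (\<integral>z. indicator upper_half_plane z / (Im z)\<^sup>2 * indicator S z \<partial>lborel)"
  proof -
    have "open upper_half_plane" by (simp add: upper_half_plane_def open_halfspace_Im_gt)
    then have [measurable]: "upper_half_plane \<in> sets borel" by simp
    have *: "hyp_area_measure = density lborel (\<lambda>z. ennreal (indicator upper_half_plane z / (Im z)\<^sup>2))"
      unfolding hyp_area_measure_def by (rule density_cong) (auto simp: indicator_def)
    show ?thesis unfolding * by (rule integral_real_density) auto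
  qed
  finally have area: "enclosed_area c = (\<integral>z. indicator upper_half_plane z / (Im z)\<^sup>2 * indicator S z \<partial>lborel)" .
  have area_strip: "(\<integral>z. strip_density a r n z * W z \<partial>lborel) = \<epsilon> * enclosed_area c" if "r \<le> n" for n
  proof -
    have "strip_density a r n z * W z = \<epsilon> * (indicator upper_half_plane z / (Im z)\<^sup>2 * indicator S z)" for z
      using S_box[OF that] S_upper by (auto simp: strip_density_def W_def indicator_def upper_half_plane_def)
    then show ?thesis unfolding area by (simp only: integral_mult_right_zero)
  qed
  define f where "f u = indicator {0..1} u * (pi * Re (c' u) * (2 / Im (c u) - 1 / a - 1 / r))" for u
  define M where "M u = (1 / a - 1 / r) * ((ln 9 + pi) * cmod (c' u))" for u
  have a_le: "a \<le> Im (c u)" "Im (c u) \<le> r" "\<bar>Re (c u)\<bar> \<le> r" if "u \<in> {0..1}" for u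
    using z0(2)[OF on[OF that]] r[OF on[OF that]] abs_Re_le_cmod[of "c u"] abs_Im_le_cmod[of "c u"]
    by (auto simp: a_def)
  have "a \<le> r" using a_le(1,2)[of 0] by simp
  have lim: "((\<lambda>n. \<integral>u. indicator {0..1} u * strip_potential a r n u \<partial>lborel) \<longlongrightarrow> (\<integral>u. f u \<partial>lborel)) at_top"
  proof (rule integral_dominated_convergence_at_top[where w = "\<lambda>u. indicator {0..1} u *\<^sub>R M u"])
    have "((\<lambda>n. indicator {0..1} u * strip_potential a r n u) \<longlongrightarrow> f u) at_top" for u
      unfolding f_def
      by (cases "u \<in> {0..1}") (use a a_le in \<open>auto intro!: strip_potential_limit\<close>)
    then show "AE u in lborel. ((\<lambda>n. indicator {0..1} u * strip_potential a r n u) \<longlongrightarrow> f u) at_top"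
      by simp
    show "\<forall>\<^sub>F n in at_top. AE u in lborel. norm (indicator {0..1} u * strip_potential a r n u) \<le> indicator {0..1} u *\<^sub>R M u"
      using eventually_ge_at_top[of "2 * r"]
    proof eventually_elim
      fix n assume n: "2 * r \<le> n"
      have "norm (indicator {0..1} u * strip_potential a r n u) \<le> indicator {0..1} u *\<^sub>R M u" for u
      proof (cases "u \<in> {0..1}")
        case True
        then have "2 * \<bar>Re (c u)\<bar> \<le> n" using a_le(3) n by force
        from strip_potential_bound[OF a \<open>a \<le> r\<close> this] show ?thesis using True by (simp add: M_def)
      qed auto
      then show "AE u in lborel. norm (indicator {0..1} u * strip_potential a r n u) \<le> indicator {0..1} u *\<^sub>R M u"
        by simp
    qed
    have "continuous_on {0..1} M"
      unfolding M_def by (intro continuous_intros continuous_on_subset[OF cont_deriv]) auto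
    then show "integrable lborel (\<lambda>u. indicator {0..1} u *\<^sub>R M u)"
      using borel_integrable_atLeastAtMost' unfolding set_integrable_def by blast
    show "(\<lambda>u. indicator {0..1} u * strip_potential a r n u) \<in> borel_measurable lborel" for n
      unfolding strip_potential_def by measurable
    show "f \<in> borel_measurable lborel"
      unfolding f_def by measurable
  qed
  have "\<forall>\<^sub>F n in at_top. (\<integral>u. indicator {0..1} u * strip_potential a r n u \<partial>lborel) = 2 * pi * (\<epsilon> * enclosed_area c)"
    using eventually_ge_at_top[of r]
  proof eventually_elim
    fix n assume n: "r \<le> n"
    have "2 * pi * (\<integral>z. strip_density a r n z * W z \<partial>lborel)
        = (\<integral>u. indicator {0..1} u * strip_potential a r n u \<partial>lborel)"
      unfolding strip_potential_def
      by (rule weighted_integral_winding_number[OF measurable_strip_density strip_density_bound[OF a]])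
        (use W in auto)
    then show "(\<integral>u. indicator {0..1} u * strip_potential a r n u \<partial>lborel) = 2 * pi * (\<epsilon> * enclosed_area c)"
      by (simp add: area_strip[OF n])
  qed
  with lim have "((\<lambda>n::real. 2 * pi * (\<epsilon> * enclosed_area c)) \<longlongrightarrow> (\<integral>u. f u \<partial>lborel)) at_top"
    by (simp add: tendsto_cong)
  then have 1: "(\<integral>u. f u \<partial>lborel) = 2 * pi * (\<epsilon> * enclosed_area c)"
    by (simp add: tendsto_const_iff)
  have cf: "continuous_on {0..1} (\<lambda>u. Re (c' u) / Im (c u))"
    using upper by (auto intro!: continuous_intros cont continuous_on_subset[OF cont_deriv] simp: less_imp_neq[symmetric])
  have cRe: "continuous_on {0..1} (\<lambda>u. Re (c' u))"
    by (intro continuous_intros continuous_on_subset[OF cont_deriv]) auto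
  have "set_integrable lborel {0..1} (\<lambda>u. Re (c' u) / Im (c u))"
    by (rule borel_integrable_atLeastAtMost'[OF cf])
  note I1 = this set_borel_integral_eq_integral(2)[OF this]
  have I2: "set_integrable lborel {0..1} (\<lambda>u. Re (c' u))"
    by (rule borel_integrable_atLeastAtMost'[OF cRe])
  have "((\<lambda>u. Re (c u)) has_vector_derivative Re (c' u)) (at u)" for u
    by (rule bounded_linear.has_vector_derivative[OF bounded_linear_Re has_deriv])
  then have I3: "(\<integral>u. indicator {0..1} u *\<^sub>R Re (c' u) \<partial>lborel) = Re (c 1) - Re (c 0)"
    by (intro integral_FTC_atLeastAtMost cRe) (auto intro: has_vector_derivative_at_within)
  have "f u = 2 * pi * (indicator {0..1} u *\<^sub>R (Re (c' u) / Im (c u)))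
      - pi * (1 / a + 1 / r) * (indicator {0..1} u *\<^sub>R Re (c' u))" for u
    by (simp add: f_def algebra_simps)
  then have "(\<integral>u. f u \<partial>lborel) = 2 * pi * integral {0..1} (\<lambda>u. Re (c' u) / Im (c u))
      - pi * (1 / a + 1 / r) * (Re (c 1) - Re (c 0))"
    using I1 I2 I3
    by (simp only: set_integrable_def set_lebesgue_integral_def
        Bochner_Integration.integral_diff integrable_mult_right integral_mult_right_zero)
  then show ?thesis using 1 periodic[of 0] by simp
qed

end

section \<open>Curvature and normal speed in the half-plane\<close>

text \<open>The Euclidean curvature contributes \<open>Im (c'' / c')\<close>, the rate of rotation of the tangent, and the
  Christoffel symbols contribute \<open>Re c' / Im c\<close>.  The derivative of the speed drops out, since it
  multiplies a tangential vector.\<close>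

lemma curvature_times_speed:
  assumes c: "\<And>v. (c has_vector_derivative c' v) (at v)"
    and c': "(c' has_vector_derivative c'') (at u)"
    and nz: "c' u \<noteq> 0" and y: "0 < Im (c u)"
  shows "geodesic_curvature c u * hyp_speed c u = Im (c'' / c' u) + Re (c' u) / Im (c u)"
proof -
  have vd: "vector_derivative c (at v) = c' v" for v by (rule vector_derivative_at[OF c])
  have nsq: "hyp_norm (c v) (c' v) = cmod (c' v) / \<bar>Im (c v)\<bar>" for v
    by (simp add: hyp_norm_def hyp_inner_def real_sqrt_divide norm_eq_sqrt_inner)
  define r where "r v = \<bar>Im (c v)\<bar> / cmod (c' v)" for v
  have T: "unit_tangent c v = r v *\<^sub>R c' v" for v
    by (simp add: unit_tangent_def hyp_speed_def vd nsq r_def)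
  have sp: "hyp_speed c u = 1 / r u" by (simp add: hyp_speed_def vd nsq r_def)
  have "r u > 0" using nz y by (simp add: r_def)
  have dc: "c differentiable (at u)" "c' differentiable (at u)"
    using c[of u] c' by (auto intro: differentiableI_vector)
  have "(\<lambda>v. Im (c v)) differentiable (at u)"
    using bounded_linear.has_vector_derivative[OF bounded_linear_Im c[of u]] by (rule differentiableI_vector)
  then have "(\<lambda>v. \<bar>Im (c v)\<bar>) differentiable (at u)"
    using differentiable_chain_at[of "\<lambda>v. Im (c v)" u norm] y by (simp add: o_def differentiable_norm_at)
  moreover have "(\<lambda>v. cmod (c' v)) differentiable (at u)"
    using differentiable_chain_at[OF dc(2), of cmod] nz by (simp add: o_def differentiable_norm_at)
  ultimately have "r differentiable (at u)"
    unfolding r_def using nz by (intro differentiable_divide) auto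
  then obtain r' where r': "(r has_real_derivative r') (at u)"
    using real_differentiable_def by blast
  have "((\<lambda>v. r v *\<^sub>R c' v) has_vector_derivative (r u *\<^sub>R c'' + r' *\<^sub>R c' u)) (at u)"
    by (rule has_vector_derivative_scaleR[OF r' c'])
  then have "vector_derivative (unit_tangent c) (at u) = r u *\<^sub>R c'' + r' *\<^sub>R c' u"
    unfolding T[abs_def] by (rule vector_derivative_at)
  then have cov: "cov_deriv c (unit_tangent c) u
      = r u *\<^sub>R c'' + r' *\<^sub>R c' u + \<i> * c' u * (r u *\<^sub>R c' u) / of_real (Im (c u))"
    by (simp add: cov_deriv_def hyp_christoffel_def vd T)
  have sq: "(r u)\<^sup>2 * ((Re (c' u))\<^sup>2 + (Im (c' u))\<^sup>2) = (Im (c u))\<^sup>2"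
    using nz by (simp add: r_def power_divide cmod_power2 complex_eq_iff sum_power2_eq_zero_iff)
  define N where "N = (Re (c' u))\<^sup>2 + (Im (c' u))\<^sup>2"
  have "N \<noteq> 0" using nz by (simp add: N_def complex_eq_iff sum_power2_eq_zero_iff)
  have "Im (c'' / c' u) = (Im c'' * Re (c' u) - Re c'' * Im (c' u)) / N"
    by (simp add: Im_divide N_def)
  then have W: "Im c'' * Re (c' u) - Re c'' * Im (c' u) + Re (c' u) * N / Im (c u)
      = N * (Im (c'' / c' u) + Re (c' u) / Im (c u))"
    using \<open>N \<noteq> 0\<close> by (simp add: distrib_left)
  have "geodesic_curvature c u * hyp_speed c u
      = (r u)\<^sup>2 * (Im c'' * Re (c' u) - Re c'' * Im (c' u) + Re (c' u) * N / Im (c u)) / (Im (c u))\<^sup>2"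
    using \<open>r u > 0\<close> y
    by (simp add: geodesic_curvature_def unit_normal_def sp T cov hyp_inner_def inner_complex_def N_def
        field_simps power2_eq_square)
  also have "\<dots> = (r u)\<^sup>2 * N * (Im (c'' / c' u) + Re (c' u) / Im (c u)) / (Im (c u))\<^sup>2"
    unfolding W by simp
  also have "\<dots> = Im (c'' / c' u) + Re (c' u) / Im (c u)"
    unfolding N_def sq using y by simp
  finally show ?thesis .
qed

text \<open>Only the normal part of the velocity enters, and the normal is \<open>\<i> c' / \<sigma>\<close>.\<close>

lemma normal_velocity_times_speed:
  assumes c: "(c has_vector_derivative c') (at u)" and nz: "c' \<noteq> 0" and y: "0 < Im (c u)"
    and flow: "normal_component c u v = k *\<^sub>R unit_normal c u"
  shows "k * hyp_speed c u = (Im v * Re c' - Re v * Im c') / (Im (c u))\<^sup>2"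
proof -
  define \<sigma> where "\<sigma> = hyp_speed c u"
  have vd: "vector_derivative c (at u) = c'" by (rule vector_derivative_at[OF c])
  have \<sigma>: "\<sigma> = cmod c' / Im (c u)"
    using y by (simp add: \<sigma>_def hyp_speed_def vd hyp_norm_def hyp_inner_def real_sqrt_divide norm_eq_sqrt_inner)
  have "\<sigma> > 0" using nz y by (simp add: \<sigma>)
  have sq: "\<sigma>\<^sup>2 * (Im (c u))\<^sup>2 = (Re c')\<^sup>2 + (Im c')\<^sup>2"
    using y by (simp add: \<sigma> power_divide cmod_power2)
  have T: "unit_tangent c u = c' /\<^sub>R \<sigma>" by (simp add: unit_tangent_def vd \<sigma>_def)
  have "hyp_inner (c u) v (unit_tangent c u) *\<^sub>R (c' /\<^sub>R \<sigma>) \<bullet> (\<i> * c') = 0"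
    by (simp add: inner_complex_def)
  then have "normal_component c u v \<bullet> (\<i> * c') = v \<bullet> (\<i> * c')"
    by (simp add: normal_component_def T inner_diff_left)
  also have "normal_component c u v \<bullet> (\<i> * c') = k / \<sigma> * ((Re c')\<^sup>2 + (Im c')\<^sup>2)"
    unfolding flow unit_normal_def T by (simp add: inner_complex_def power2_eq_square distrib_left add_divide_distrib mult_ac divide_inverse)
  also have "\<dots> = k * \<sigma> * (Im (c u))\<^sup>2"
    unfolding sq[symmetric] using \<open>\<sigma> > 0\<close> by (simp add: power2_eq_square)
  finally show ?thesis using y by (simp add: inner_complex_def field_simps \<sigma>_def[symmetric])
qed

section \<open>Partial derivatives of smooth maps of two variables\<close>

lemma Ck_on_continuous: "Ck_on k S f \<Longrightarrow> continuous_on S f"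
  by (cases k)
    (auto intro!: continuous_at_imp_continuous_on differentiable_imp_continuous_within)

lemma Ck_on_partial_snd:
  assumes "Ck_on (Suc k) S f" "(t, u) \<in> S"
  shows "((\<lambda>u. f (t, u)) has_vector_derivative frechet_derivative f (at (t, u)) (0, 1)) (at u)"
proof -
  have "(f has_derivative frechet_derivative f (at (t, u))) (at (t, u))"
    using assms by (simp add: frechet_derivative_works)
  moreover have "((\<lambda>u. (t, u)) has_vector_derivative (0, 1)) (at u)"
    by (rule has_vector_derivative_Pair) auto
  ultimately show ?thesis
    using vector_derivative_diff_chain_within[of "\<lambda>u. (t, u)" "(0, 1)" u UNIV f]
    by (simp add: o_def has_derivative_at_withinI)
qed

lemma Ck_on_partial_fst:
  assumes "Ck_on (Suc k) S f" "(t, u) \<in> S"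
  shows "((\<lambda>t. f (t, u)) has_vector_derivative frechet_derivative f (at (t, u)) (1, 0)) (at t)"
proof -
  have "(f has_derivative frechet_derivative f (at (t, u))) (at (t, u))"
    using assms by (simp add: frechet_derivative_works)
  moreover have "((\<lambda>t. (t, u)) has_vector_derivative (1, 0)) (at t)"
    by (rule has_vector_derivative_Pair) auto
  ultimately show ?thesis
    using vector_derivative_diff_chain_within[of "\<lambda>t. (t, u)" "(1, 0)" t UNIV f]
    by (simp add: o_def has_derivative_at_withinI)
qed

text \<open>Differentiating \<open>f t b - f t a = \<integral> p t\<close> in \<open>t\<close> under the integral gives \<open>q t b - q t a = \<integral> r t\<close>, which can
  then be differentiated in \<open>b\<close>.\<close>

lemma mixed_partial_commute:
  fixes f q p r :: "real \<Rightarrow> real \<Rightarrow> complex"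
  assumes J: "open J" "convex J" "t \<in> J"
    and ft: "\<And>t u. t \<in> J \<Longrightarrow> ((\<lambda>t. f t u) has_vector_derivative q t u) (at t)"
    and fu: "\<And>t u. t \<in> J \<Longrightarrow> ((\<lambda>u. f t u) has_vector_derivative p t u) (at u)"
    and put: "\<And>t u. t \<in> J \<Longrightarrow> ((\<lambda>t. p t u) has_vector_derivative r t u) (at t)"
    and cont: "continuous_on (J \<times> UNIV) (\<lambda>(t, u). r t u)"
  shows "((\<lambda>u. q t u) has_vector_derivative r t u) (at u)"
proof -
  have int: "(p s has_integral f s b - f s a) {a..b}" if "s \<in> J" "a \<le> b" for s a b
    by (rule fundamental_theorem_of_calculus) (use that fu in \<open>auto intro: has_vector_derivative_at_within\<close>)
  have diff: "q t b - q t a = integral {a..b} (r t)" if "a \<le> b" for a b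
  proof -
    have leib: "((\<lambda>s. integral (cbox a b) (p s)) has_vector_derivative integral (cbox a b) (r t)) (at t within J)"
    proof (rule leibniz_rule_vector_derivative)
      show "((\<lambda>t. p t u) has_vector_derivative r s u) (at s within J)" if "s \<in> J" for s u
        using put[OF that] by (rule has_vector_derivative_at_within)
      show "p s integrable_on cbox a b" if "s \<in> J" for s
        using int[OF that \<open>a \<le> b\<close>] by (auto simp: integrable_on_def)
      show "continuous_on (J \<times> cbox a b) (\<lambda>(t, u). r t u)"
        by (rule continuous_on_subset[OF cont]) auto
    qed (use J in auto)
    have eq: "f s b - f s a = integral {a..b} (p s)" if "s \<in> J" for s
      using int[OF that \<open>a \<le> b\<close>] by (simp add: integral_unique)
    have "((\<lambda>s. integral {a..b} (p s)) has_vector_derivative integral {a..b} (r t)) (at t within J)"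
      using leib by simp
    then have "((\<lambda>s. f s b - f s a) has_vector_derivative integral {a..b} (r t)) (at t within J)"
      by (rule has_vector_derivative_transform[where f = "\<lambda>s. integral {a..b} (p s)", rotated 2])
        (fact J(3), rule eq)
    then have "((\<lambda>s. f s b - f s a) has_vector_derivative integral {a..b} (r t)) (at t)"
      unfolding at_within_open[OF J(3,1)] .
    moreover have "((\<lambda>s. f s b - f s a) has_vector_derivative q t b - q t a) (at t)"
      by (intro has_vector_derivative_diff ft J)
    ultimately show ?thesis using vector_derivative_unique_at by blast
  qed
  have contr: "continuous_on X (r t)" for X
  proof -
    have "continuous_on X (\<lambda>u. (t, u))" by (intro continuous_intros)
    from continuous_on_compose2[OF cont this] show ?thesis using J(3) by auto
  qed
  have "((\<lambda>v. integral {u - 1..v} (r t)) has_vector_derivative r t u) (at u within {u - 1..u + 1})"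
    by (rule integral_has_vector_derivative) (auto intro: contr)
  then have deriv: "((\<lambda>v. q t (u - 1) + integral {u - 1..v} (r t)) has_vector_derivative r t u) (at u within {u - 1..u + 1})"
    using has_vector_derivative_add[OF has_vector_derivative_const] by fastforce
  have "q t v = q t (u - 1) + integral {u - 1..v} (r t)" if "v \<in> {u - 1..u + 1}" for v
    using diff[of "u - 1" v] that by (simp add: algebra_simps)
  moreover have "u \<in> {u - 1..u + 1}" by auto
  ultimately have "(q t has_vector_derivative r t u) (at u within {u - 1..u + 1})"
    using has_vector_derivative_transform[OF _ _ deriv] by blast
  then show ?thesis
    by (simp add: at_within_Icc_at)
qed

section \<open>Evolution of the enclosed area\<close>

lemma has_derivative_Re_divide_Im:
  assumes f: "(f has_vector_derivative f') (at x)" and g: "(g has_vector_derivative g') (at x)"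
    and nz: "Im (g x) \<noteq> 0"
  shows "((\<lambda>x. Re (f x) / Im (g x)) has_vector_derivative
    Re f' / Im (g x) - Re (f x) * Im g' / (Im (g x))\<^sup>2) (at x)"
proof -
  have "((\<lambda>x. Re (f x)) has_real_derivative Re f') (at x)"
    using bounded_linear.has_vector_derivative[OF bounded_linear_Re f]
    by (simp add: has_real_derivative_iff_has_vector_derivative)
  moreover have "((\<lambda>x. Im (g x)) has_real_derivative Im g') (at x)"
    using bounded_linear.has_vector_derivative[OF bounded_linear_Im g]
    by (simp add: has_real_derivative_iff_has_vector_derivative)
  ultimately have "((\<lambda>x. Re (f x) / Im (g x)) has_real_derivative
      (Re f' * Im (g x) - Re (f x) * Im g') / (Im (g x) * Im (g x))) (at x)"
    using nz by (rule DERIV_divide)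
  moreover have "(Re f' * Im (g x) - Re (f x) * Im g') / (Im (g x) * Im (g x))
      = Re f' / Im (g x) - Re (f x) * Im g' / (Im (g x))\<^sup>2"
    using nz by (simp add: diff_divide_distrib power2_eq_square)
  ultimately show ?thesis
    by (simp add: has_real_derivative_iff_has_vector_derivative)
qed

locale embedded_curve_shortening_flow =
  fixes J :: "real set" and \<gamma> :: "real \<Rightarrow> real \<Rightarrow> complex"
  assumes open_time: "open J" and convex_time: "convex J"
    and flow: "csf_solution J \<gamma>"
    and embedded: "\<And>t. t \<in> J \<Longrightarrow> simple_closed_curve (\<gamma> t)"
begin

definition \<gamma>\<^sub>u :: "real \<Rightarrow> real \<Rightarrow> complex" where
  "\<gamma>\<^sub>u t u = frechet_derivative (\<lambda>(t, u). \<gamma> t u) (at (t, u)) (0, 1)"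

definition \<gamma>\<^sub>t :: "real \<Rightarrow> real \<Rightarrow> complex" where
  "\<gamma>\<^sub>t t u = frechet_derivative (\<lambda>(t, u). \<gamma> t u) (at (t, u)) (1, 0)"

definition \<gamma>\<^sub>u\<^sub>u :: "real \<Rightarrow> real \<Rightarrow> complex" where
  "\<gamma>\<^sub>u\<^sub>u t u = frechet_derivative (\<lambda>(t, u). \<gamma>\<^sub>u t u) (at (t, u)) (0, 1)"

definition \<gamma>\<^sub>u\<^sub>t :: "real \<Rightarrow> real \<Rightarrow> complex" where
  "\<gamma>\<^sub>u\<^sub>t t u = frechet_derivative (\<lambda>(t, u). \<gamma>\<^sub>u t u) (at (t, u)) (1, 0)"

lemma Ck: "Ck_on k (J \<times> UNIV) (\<lambda>(t, u). \<gamma> t u)" "Ck_on k (J \<times> UNIV) (\<lambda>(t, u). \<gamma>\<^sub>u t u)"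
  "Ck_on k (J \<times> UNIV) (\<lambda>(t, u). \<gamma>\<^sub>t t u)" "Ck_on k (J \<times> UNIV) (\<lambda>(t, u). \<gamma>\<^sub>u\<^sub>u t u)"
  "Ck_on k (J \<times> UNIV) (\<lambda>(t, u). \<gamma>\<^sub>u\<^sub>t t u)"
proof -
  have smooth: "Ck_on k (J \<times> UNIV) (\<lambda>(t, u). \<gamma> t u)" for k
    using flow by (auto simp: csf_solution_def smooth_curve_family_def smooth_on_def)
  then show "Ck_on k (J \<times> UNIV) (\<lambda>(t, u). \<gamma> t u)" .
  have \<gamma>u: "Ck_on k (J \<times> UNIV) (\<lambda>(t, u). \<gamma>\<^sub>u t u)" for k
    using smooth[of "Suc k"] by (simp add: \<gamma>\<^sub>u_def case_prod_unfold)
  then show "Ck_on k (J \<times> UNIV) (\<lambda>(t, u). \<gamma>\<^sub>u t u)" .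
  show "Ck_on k (J \<times> UNIV) (\<lambda>(t, u). \<gamma>\<^sub>t t u)"
    using smooth[of "Suc k"] by (simp add: \<gamma>\<^sub>t_def case_prod_unfold)
  show "Ck_on k (J \<times> UNIV) (\<lambda>(t, u). \<gamma>\<^sub>u\<^sub>u t u)"
    using \<gamma>u[of "Suc k"] by (simp add: \<gamma>\<^sub>u\<^sub>u_def case_prod_unfold)
  show "Ck_on k (J \<times> UNIV) (\<lambda>(t, u). \<gamma>\<^sub>u\<^sub>t t u)"
    using \<gamma>u[of "Suc k"] by (simp add: \<gamma>\<^sub>u\<^sub>t_def case_prod_unfold)
qed

lemmas cont = Ck[THEN Ck_on_continuous]

lemma derivs:
  assumes "t \<in> J"
  shows "(\<gamma> t has_vector_derivative \<gamma>\<^sub>u t u) (at u)"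
    and "((\<lambda>t. \<gamma> t u) has_vector_derivative \<gamma>\<^sub>t t u) (at t)"
    and "(\<gamma>\<^sub>u t has_vector_derivative \<gamma>\<^sub>u\<^sub>u t u) (at u)"
    and "((\<lambda>t. \<gamma>\<^sub>u t u) has_vector_derivative \<gamma>\<^sub>u\<^sub>t t u) (at t)"
  using Ck_on_partial_snd[OF Ck(1), of t u] Ck_on_partial_fst[OF Ck(1), of t u]
    Ck_on_partial_snd[OF Ck(2), of t u] Ck_on_partial_fst[OF Ck(2), of t u] assms
  by (simp_all add: \<gamma>\<^sub>u_def[symmetric] \<gamma>\<^sub>t_def[symmetric] \<gamma>\<^sub>u\<^sub>u_def[symmetric] \<gamma>\<^sub>u\<^sub>t_def[symmetric])

lemma deriv_\<gamma>\<^sub>t: "t \<in> J \<Longrightarrow> (\<gamma>\<^sub>t t has_vector_derivative \<gamma>\<^sub>u\<^sub>t t u) (at u)"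
  using mixed_partial_commute[OF open_time convex_time _ derivs(2,1,4) cont(5)] by blast

lemma cont_slice:
  assumes "continuous_on (J \<times> UNIV) (\<lambda>(t, u). f t u)" "t \<in> J"
  shows "continuous_on X (f t)"
proof -
  have "continuous_on X (\<lambda>u. (t, u))" by (intro continuous_intros)
  from continuous_on_compose2[OF assms(1) this] show ?thesis using assms(2) by auto
qed

lemma upper: "t \<in> J \<Longrightarrow> 0 < Im (\<gamma> t u)"
  using flow by (auto simp: csf_solution_def smooth_curve_family_def upper_half_plane_def)

lemma immersed: "t \<in> J \<Longrightarrow> \<gamma>\<^sub>u t u \<noteq> 0"
  using flow vector_derivative_at[OF derivs(1)] by (auto simp: csf_solution_def smooth_curve_family_def)

lemma curve: "t \<in> J \<Longrightarrow> simple_closed_C1_curve (\<gamma> t) (\<gamma>\<^sub>u t)"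
  using embedded[of t] by unfold_locales
    (auto simp: simple_closed_curve_def immersed intro: derivs cont_slice[OF cont(2)])

lemma tangent: "t \<in> J \<Longrightarrow> closed_C1_curve (\<gamma>\<^sub>u t) (\<gamma>\<^sub>u\<^sub>u t)"
proof
  assume t: "t \<in> J"
  interpret simple_closed_C1_curve "\<gamma> t" "\<gamma>\<^sub>u t" by (rule curve[OF t])
  show "\<gamma>\<^sub>u t (u + 1) = \<gamma>\<^sub>u t u" for u by (rule periodic_deriv)
qed (auto intro: derivs cont_slice[OF cont(4)])

text \<open>Taking the turning number as the sign of the parametrisation gives it an integral formula, from which
  its continuity in time can be read off.\<close>

definition orientation :: "real \<Rightarrow> real" where
  "orientation t = Re (winding_number (\<gamma>\<^sub>u t) 0)"

lemma orientation:
  assumes t: "t \<in> J"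
  shows "orientation t \<in> {1, - 1}"
    and "z \<in> inside (path_image (\<gamma> t)) \<Longrightarrow> winding_number (\<gamma> t) z = of_real (orientation t)"
proof -
  interpret simple_closed_C1_curve "\<gamma> t" "\<gamma>\<^sub>u t" by (rule curve[OF t])
  have *: "winding_number (\<gamma> t) z = winding_number (\<gamma>\<^sub>u t) 0 \<and> winding_number (\<gamma> t) z \<in> {1, - 1}"
    if "z \<in> inside (path_image (\<gamma> t))" for z
    using turning_number_eq_winding_number_inside[OF that]
      simple_closed_path_winding_number_inside[OF simple] that by (metis insertCI)
  obtain z0 where "z0 \<in> inside (path_image (\<gamma> t))"
    using Jordan_inside_outside[OF simple pathfinish] by auto
  from *[OF this] have "winding_number (\<gamma>\<^sub>u t) 0 \<in> {1, - 1}" by metis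
  then show "orientation t \<in> {1, - 1}" by (auto simp: orientation_def)
  show "winding_number (\<gamma> t) z = of_real (orientation t)" if "z \<in> inside (path_image (\<gamma> t))"
  proof -
    have "w = of_real (Re w)" if "w \<in> {1, - 1}" for w :: complex using that by auto
    then show ?thesis using *[OF that] unfolding orientation_def by metis
  qed
qed

definition signed_area :: "real \<Rightarrow> real" where
  "signed_area t = integral {0..1} (\<lambda>u. Re (\<gamma>\<^sub>u t u) / Im (\<gamma> t u))"

lemma signed_area:
  assumes t: "t \<in> J"
  shows "signed_area t = orientation t * enclosed_area (\<gamma> t)"
proof -
  interpret simple_closed_C1_curve "\<gamma> t" "\<gamma>\<^sub>u t" by (rule curve[OF t])
  show ?thesis
    unfolding signed_area_def
    by (rule enclosed_area_eq_line_integral[symmetric, OF upper[OF t] orientation(2)[OF t]])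
qed

lemma has_integral_turning:
  assumes t: "t \<in> J"
  shows "((\<lambda>u. Im (\<gamma>\<^sub>u\<^sub>u t u / \<gamma>\<^sub>u t u)) has_integral 2 * pi * orientation t) {0..1}"
proof -
  have "0 \<notin> path_image (\<gamma>\<^sub>u t)" using immersed[OF t] by (auto simp: path_image_def)
  from closed_C1_curve.has_integral_Re_winding_number[OF tangent[OF t] this]
  show ?thesis by (simp add: orientation_def)
qed

text \<open>By \<open>has_integral_turning\<close>, \<open>2 \<pi>\<close> times the sign is an integral that depends continuously on time, and
  a continuous function on an interval with values in \<open>{1, - 1}\<close> is constant.\<close>

lemma orientation_constant:
  assumes "s \<in> J" "t \<in> J"
  shows "orientation s = orientation t"
proof -
  have "continuous_on (J \<times> UNIV) (\<lambda>x. Im (\<gamma>\<^sub>u\<^sub>u (fst x) (snd x) / \<gamma>\<^sub>u (fst x) (snd x)))"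
    using cont(2,4) immersed by (auto simp: case_prod_unfold intro!: continuous_intros)
  then have "continuous_on J (\<lambda>t. integral (cbox 0 1) (\<lambda>u. Im (\<gamma>\<^sub>u\<^sub>u t u / \<gamma>\<^sub>u t u)))"
    by (intro integral_continuous_on_param)
      (auto simp: case_prod_unfold elim: continuous_on_subset)
  then have "continuous_on J (\<lambda>t. integral (cbox 0 1) (\<lambda>u. Im (\<gamma>\<^sub>u\<^sub>u t u / \<gamma>\<^sub>u t u)) / (2 * pi))"
    by (intro continuous_intros) auto
  then have "continuous_on J orientation"
    by (rule continuous_on_eq) (simp add: integral_unique[OF has_integral_turning])
  moreover have "finite (orientation ` J)"
    by (rule finite_subset[of _ "{1, - 1}"]) (use orientation(1) in auto)
  ultimately have "orientation constant_on J"
    using convex_time by (intro continuous_finite_range_constant) (auto intro: convex_connected)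
  then show ?thesis using assms by (auto simp: constant_on_def)
qed

text \<open>The time derivative of the integrand \<open>Re \<gamma>\<^sub>u / Im \<gamma>\<close> differs from \<open>- \<kappa> \<sigma>\<close> by the \<open>u\<close>-derivative \<open>k\<close> of
  the periodic function \<open>Re \<gamma>\<^sub>t / Im \<gamma>\<close>.\<close>

lemma signed_area_has_derivative:
  assumes t: "t \<in> J"
  shows "(signed_area has_real_derivative - (2 * pi * orientation t + signed_area t)) (at t)"
proof -
  define h where "h s u = Re (\<gamma>\<^sub>u\<^sub>t s u) / Im (\<gamma> s u) - Re (\<gamma>\<^sub>u s u) * Im (\<gamma>\<^sub>t s u) / (Im (\<gamma> s u))\<^sup>2" for s u
  have nz: "Im (\<gamma> s u) \<noteq> 0" if "s \<in> J" for s u using upper[OF that, of u] by simp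
  have cont_prod: "continuous_on (J \<times> UNIV) (\<lambda>x. \<gamma> (fst x) (snd x))" "continuous_on (J \<times> UNIV) (\<lambda>x. \<gamma>\<^sub>u (fst x) (snd x))"
    "continuous_on (J \<times> UNIV) (\<lambda>x. \<gamma>\<^sub>t (fst x) (snd x))" "continuous_on (J \<times> UNIV) (\<lambda>x. \<gamma>\<^sub>u\<^sub>t (fst x) (snd x))"
    using cont by (simp_all add: case_prod_unfold)
  have cont_h: "continuous_on (J \<times> UNIV) (\<lambda>(s, u). h s u)"
    unfolding h_def case_prod_unfold using nz
    by (intro continuous_intros cont_prod) auto
  have cont_line: "continuous_on X (\<lambda>u. Re (\<gamma>\<^sub>u s u) / Im (\<gamma> s u))" if "s \<in> J" for s X
    using nz that by (intro continuous_intros cont_slice[OF cont(1)] cont_slice[OF cont(2)]) auto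
  have "((\<lambda>s. integral (cbox 0 1) (\<lambda>u. Re (\<gamma>\<^sub>u s u) / Im (\<gamma> s u))) has_vector_derivative integral (cbox 0 1) (h t)) (at t within J)"
  proof (rule leibniz_rule_vector_derivative)
    show "((\<lambda>s. Re (\<gamma>\<^sub>u s u) / Im (\<gamma> s u)) has_vector_derivative h s u) (at s within J)" if "s \<in> J" for s u
      unfolding h_def
      by (rule has_vector_derivative_at_within[OF has_derivative_Re_divide_Im[OF derivs(4) derivs(2) nz]]) (fact that)+
    show "(\<lambda>u. Re (\<gamma>\<^sub>u s u) / Im (\<gamma> s u)) integrable_on cbox 0 1" if "s \<in> J" for s
      by (rule integrable_continuous[OF cont_line[OF that]])
    show "continuous_on (J \<times> cbox 0 1) (\<lambda>(s, u). h s u)"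
      by (rule continuous_on_subset[OF cont_h]) auto
  qed (fact t convex_time)+
  then have deriv: "(signed_area has_real_derivative integral {0..1} (h t)) (at t)"
    unfolding at_within_open[OF t open_time]
    by (simp add: signed_area_def[abs_def] has_real_derivative_iff_has_vector_derivative)

  define k where "k u = Re (\<gamma>\<^sub>u\<^sub>t t u) / Im (\<gamma> t u) - Re (\<gamma>\<^sub>t t u) * Im (\<gamma>\<^sub>u t u) / (Im (\<gamma> t u))\<^sup>2" for u
  have k_deriv: "((\<lambda>u. Re (\<gamma>\<^sub>t t u) / Im (\<gamma> t u)) has_vector_derivative k u) (at u)" for u
    unfolding k_def by (rule has_derivative_Re_divide_Im[OF deriv_\<gamma>\<^sub>t derivs(1) nz]) (fact t)+
  have closed: "\<gamma> s 1 = \<gamma> s 0" if "s \<in> J" for s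
  proof -
    have "\<gamma> s (0 + 1) = \<gamma> s 0" using embedded[OF that] unfolding simple_closed_curve_def by blast
    then show ?thesis by simp
  qed
  have "((\<lambda>s. \<gamma> s 0) has_vector_derivative \<gamma>\<^sub>t t 1) (at t)"
    by (rule has_vector_derivative_transform_within_open[OF derivs(2)[OF t] open_time t closed])
  then have "\<gamma>\<^sub>t t 1 = \<gamma>\<^sub>t t 0"
    using derivs(2)[OF t] vector_derivative_unique_at by blast
  moreover have "(k has_integral Re (\<gamma>\<^sub>t t 1) / Im (\<gamma> t 1) - Re (\<gamma>\<^sub>t t 0) / Im (\<gamma> t 0)) {0..1}"
    by (rule fundamental_theorem_of_calculus) (simp_all add: k_deriv has_vector_derivative_at_within)
  ultimately have k: "(k has_integral 0) {0..1}"
    using closed[OF t] by simp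

  have kappa: "h t u - k u = - (Im (\<gamma>\<^sub>u\<^sub>u t u / \<gamma>\<^sub>u t u) + Re (\<gamma>\<^sub>u t u) / Im (\<gamma> t u))" for u
  proof -
    have "normal_component (\<gamma> t) u (vector_derivative (\<lambda>s. \<gamma> s u) (at t))
        = geodesic_curvature (\<gamma> t) u *\<^sub>R unit_normal (\<gamma> t) u"
      using flow t unfolding csf_solution_def by blast
    then have "normal_component (\<gamma> t) u (\<gamma>\<^sub>t t u) = geodesic_curvature (\<gamma> t) u *\<^sub>R unit_normal (\<gamma> t) u"
      unfolding vector_derivative_at[OF derivs(2)[OF t]] .
    from normal_velocity_times_speed[OF derivs(1)[OF t] immersed[OF t] upper[OF t] this]
      curvature_times_speed[OF derivs(1)[OF t] derivs(3)[OF t] immersed[OF t] upper[OF t]]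
    show ?thesis by (simp add: h_def k_def diff_divide_distrib mult.commute)
  qed
  have "((\<lambda>u. Re (\<gamma>\<^sub>u t u) / Im (\<gamma> t u)) has_integral signed_area t) {0..1}"
    unfolding signed_area_def by (intro integrable_integral integrable_continuous_real cont_line t)
  from has_integral_add[OF k has_integral_neg[OF has_integral_add[OF has_integral_turning[OF t] this]]]
  have "(h t has_integral 0 + - (2 * pi * orientation t + signed_area t)) {0..1}"
    unfolding kappa[symmetric] by simp
  then show ?thesis using deriv by (simp add: integral_unique)
qed

text \<open>With a constant sign \<open>\<epsilon>\<close>, the equation \<open>a' = - (2 \<pi> \<epsilon> + a)\<close> for \<open>a = \<epsilon> A\<close> becomes the one for \<open>A\<close>.\<close>

theorem enclosed_area_has_derivative:
  assumes t: "t \<in> J"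
  shows "((\<lambda>t. enclosed_area (\<gamma> t)) has_real_derivative - (2 * pi + enclosed_area (\<gamma> t))) (at t)"
proof -
  define \<epsilon> where "\<epsilon> = orientation t"
  have \<epsilon>: "\<epsilon> * \<epsilon> = 1" using orientation(1)[OF t] by (auto simp: \<epsilon>_def)
  have A: "enclosed_area (\<gamma> s) = \<epsilon> * signed_area s" if "s \<in> J" for s
    using signed_area[OF that] orientation_constant[OF that t] \<epsilon>
    by (simp add: \<epsilon>_def flip: mult.assoc)
  have "((\<lambda>s. \<epsilon> * signed_area s) has_real_derivative \<epsilon> * - (2 * pi * \<epsilon> + signed_area t)) (at t)"
    unfolding \<epsilon>_def by (rule DERIV_cmult[OF signed_area_has_derivative[OF t]])
  moreover have "\<epsilon> * - (2 * pi * \<epsilon> + signed_area t) = - (2 * pi * (\<epsilon> * \<epsilon>) + enclosed_area (\<gamma> t))"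
    by (simp add: A[OF t] algebra_simps)
  ultimately have "((\<lambda>s. \<epsilon> * signed_area s) has_real_derivative - (2 * pi + enclosed_area (\<gamma> t))) (at t)"
    by (simp add: \<epsilon>)
  then show ?thesis
    by (rule has_field_derivative_transform_within_open[OF _ open_time t]) (simp add: A)
qed

end

theorem theorem5p1:
  fixes J :: "real set" and \<gamma> :: "real \<Rightarrow> real \<Rightarrow> complex"
  assumes "ancient_interval J"
    and "csf_solution J \<gamma>"
    and "\<And>t. t \<in> J \<Longrightarrow> simple_closed_curve (\<gamma> t)"
  shows "filterlim (\<lambda>t. enclosed_area (\<gamma> t)) at_top at_bot"
proof -
  obtain T0 :: ereal where T0: "- \<infinity> < T0" "J = {t. ereal t < T0}"
    using assms(1) by (auto simp: ancient_interval_def)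
  have "J = ereal -` {..<T0}" using T0(2) by auto
  then have "open J" by (simp add: open_ereal_vimage)
  moreover have down: "s \<in> J" if "t \<in> J" "s \<le> t" for s t
    using that T0(2) by (auto intro: le_less_trans[of "ereal s" "ereal t"])
  then have "is_interval J" unfolding is_interval_1 by blast
  then have "convex J" by (simp add: is_interval_convex)
  ultimately interpret embedded_curve_shortening_flow J \<gamma>
    using assms(2,3) by unfold_locales
  obtain t0 where t0: "t0 \<in> J"
    using T0 ereal_dense2[OF T0(1)] by (metis (mono_tags) mem_Collect_eq)
  have lower: "enclosed_area (\<gamma> t0) + 2 * pi * (t0 - t) \<le> enclosed_area (\<gamma> t)" if "t \<le> t0" for t
  proof -
    have "enclosed_area (\<gamma> t0) + 2 * pi * t0 \<le> enclosed_area (\<gamma> t) + 2 * pi * t"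
    proof (rule DERIV_nonpos_imp_nonincreasing[OF that])
      fix s assume "t \<le> s" "s \<le> t0"
      then have s: "s \<in> J" using down[OF t0] by simp
      have "((\<lambda>s. enclosed_area (\<gamma> s) + 2 * pi * s) has_real_derivative - enclosed_area (\<gamma> s)) (at s)"
        using enclosed_area_has_derivative[OF s] by (auto intro!: derivative_eq_intros)
      moreover have "enclosed_area (\<gamma> s) \<ge> 0" by (simp add: enclosed_area_def)
      ultimately show "\<exists>y. ((\<lambda>s. enclosed_area (\<gamma> s) + 2 * pi * s) has_real_derivative y) (at s) \<and> y \<le> 0"
        by (intro exI[of _ "- enclosed_area (\<gamma> s)"]) simp
    qed
    then show ?thesis by (simp add: algebra_simps)
  qed
  have "filterlim (\<lambda>t::real. A + 2 * pi * (t0 - t)) at_top at_bot" for A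
    by real_asymp
  from this[of "enclosed_area (\<gamma> t0)"] show ?thesis
    by (rule filterlim_at_top_mono)
      (rule eventually_mono[OF eventually_le_at_bot[of t0] lower])
qed

end
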